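(* Let $n\ge 1$ and let $D=(D_1,\ldots,D_n)$ be a diagram contained in $[n]^2$. The Schur character $\chi_D(\mathbf{x})=\chi_D(x_1,\ldots,x_n)$ attains the upper bound, i.e. $$\chi_D(\mathbf{x})=\sum_{\{C:\ |C_j|=|D_j|\ \forall j\in[n]\}}\mathbf{x}^C$$ (the sum over all diagrams $C=(C_1,\ldots,C_n)$, $C_j\subseteq[n]$, with $|C_j|=|D_j|$ for all $j$), if and only if $D$ avoids both of the following configurations: there exist rows $i_1<i_2$ and columns $j_1<j_2$ such that either (first configuration) $(i_1,j_1),(i_1,j_2)\notin D$ and $(i_2,j_1),(i_2,j_2)\in D$, or (second configuration) $(i_1,j_1),(i_1,j_2)\in D$ and $(i_2,j_1),(i_2,j_2)\notin D$.
   Context: Notation: $[n]=\{1,\ldots,n\}$. A diagram $D$ is a subset of the $n\times n$ grid $[n]^2$, identified with the list $D=(D_1,\ldots,D_n)$ of subsets of $[n]$, where $D_j=\{i: (i,j)\in D\}$ is the set of row indices of boxes in column $j$. For a diagram $C=(C_1,\ldots,C_n)$ put $\mathbf{x}^C=\prod_{j=1}^n\prod_{i\in C_j}x_i$. Schur character: let $Y=(y_{i,j})_{1\le i,j\le n}$ be a matrix of indeterminates. For $C$ with $|C_j|=|D_j|$ for all $j$, let $Y_{D_j}^{C_j}$ be the submatrix of $Y$ with row set $C_j$ and column set $D_j$ (both in increasing order; the empty determinant is $1$). The Weyl module is $$\mathbb{W}_D=\mathrm{Span}_{\mathbb{C}}\Big\{\prod_{j=1}^n\det\big(Y_{D_j}^{C_j}\big)\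 :\ C=(C_1,\ldots,C_n),\ C_j\subseteq[n],\ |C_j|=|D_j|\text{ for all }j\Big\}\subset\mathbb{C}[Y],$$ with $G=GL_n(\mathbb{C})$ acting by $f(Y)\cdot g=f(g^{-1}Y)$. For a $G$-module $N$, $\mathrm{char}(N)(x_1,\ldots,x_n)$ is the trace on $N$ of the diagonal matrix with entries $x_1,\ldots,x_n$, and the dual character is $\mathrm{char}^*(N)(x_1,\ldots,x_n)=\mathrm{char}(N)(x_1^{-1},\ldots,x_n^{-1})$. The Schur character is $\chi_D=\mathrm{char}^*(\mathbb{W}_D)$, a polynomial with nonnegative integer coefficients. *)

theory Defs
  imports
    "HOL-Library.Poly_Mapping"
    "Jordan_Normal_Form.Determinant"
    "Jordan_Normal_Form.DL_Submatrix"
begin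

text \<open>
  Rows and columns are numbered from \<open>0\<close>, as in the matrix library: \<open>[n]\<close> is rendered
  as \<open>{..<n}\<close>.
\<close>

section \<open>Diagrams\<close>

definition diagrams :: "nat \<Rightarrow> (nat \<times> nat) set set" where
  "diagrams n = Pow ({..<n} \<times> {..<n})"

definition column :: "(nat \<times> nat) set \<Rightarrow> nat \<Rightarrow> nat set" where
  "column D j = {i. (i, j) \<in> D}"

definition same_column_sizes :: "nat \<Rightarrow> (nat \<times> nat) set \<Rightarrow> (nat \<times> nat) set set" where
  "same_column_sizes n D =
     {C \<in> diagrams n. \<forall>j<n. card (column C j) = card (column D j)}"

definition diagram_monomial :: "nat \<Rightarrow> (nat \<Rightarrow> 'a::comm_monoid_mult) \<Rightarrow> (nat \<times> nat) set \<Rightarrow> 'a" where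
  "diagram_monomial n x C = (\<Prod>j<n. \<Prod>i\<in>column C j. x i)"

definition has_first_configuration :: "nat \<Rightarrow> (nat \<times> nat) set \<Rightarrow> bool" where
  "has_first_configuration n D \<longleftrightarrow>
     (\<exists>i1 i2 j1 j2. i1 < i2 \<and> i2 < n \<and> j1 < j2 \<and> j2 < n \<and>
        (i1, j1) \<notin> D \<and> (i1, j2) \<notin> D \<and> (i2, j1) \<in> D \<and> (i2, j2) \<in> D)"

definition has_second_configuration :: "nat \<Rightarrow> (nat \<times> nat) set \<Rightarrow> bool" where
  "has_second_configuration n D \<longleftrightarrow>
     (\<exists>i1 i2 j1 j2. i1 < i2 \<and> i2 < n \<and> j1 < j2 \<and> j2 < n \<and>
        (i1, j1) \<in> D \<and> (i1, j2) \<in> D \<and> (i2, j1) \<notin> D \<and> (i2, j2) \<notin> D)"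


section \<open>The polynomial ring in the entries of a matrix\<close>

text \<open>
  A monomial is a finitely supported exponent function on the variables \<open>y\<^sub>i\<^sub>j\<close>, indexed by
  the pairs \<open>(i, j)\<close>. All pairs of naturals are available as variables; the matrix \<open>Y\<close> for a
  given \<open>n\<close> uses those with \<open>i, j < n\<close>.
\<close>

type_synonym ypoly = "((nat \<times> nat) \<Rightarrow>\<^sub>0 nat) \<Rightarrow>\<^sub>0 complex"

definition yconst :: "complex \<Rightarrow> ypoly" where
  "yconst c = Poly_Mapping.single 0 c"

definition yvar :: "nat \<times> nat \<Rightarrow> ypoly" where
  "yvar v = Poly_Mapping.single (Poly_Mapping.single v 1) 1"

definition yscale :: "complex \<Rightarrow> ypoly \<Rightarrow> ypoly" where
  "yscale c f = yconst c * f"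

definition ysubst :: "(nat \<times> nat \<Rightarrow> ypoly) \<Rightarrow> ypoly \<Rightarrow> ypoly" where
  "ysubst \<sigma> f =
     (\<Sum>m\<in>Poly_Mapping.keys f. yconst (Poly_Mapping.lookup f m) *
        (\<Prod>v\<in>Poly_Mapping.keys m. \<sigma> v ^ Poly_Mapping.lookup m v))"

interpretation ypoly: vector_space yscale
proof
  fix a b :: complex and f g :: ypoly
  have add: "yconst (a + b) = yconst a + yconst b"
    by (simp add: yconst_def single_add)
  have mult: "yconst a * yconst b = yconst (a * b)"
    by (simp add: yconst_def mult_single)
  show "yscale a (f + g) = yscale a f + yscale a g"
    by (simp add: yscale_def distrib_left)
  show "yscale (a + b) f = yscale a f + yscale b f"
    by (simp add: yscale_def add distrib_right)
  show "yscale a (yscale b f) = yscale (a * b) f"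
    by (simp add: yscale_def mult mult.assoc[symmetric])
  show "yscale 1 f = f"
    by (simp add: yscale_def yconst_def)
qed

definition Ymat :: "nat \<Rightarrow> ypoly mat" where
  "Ymat n = mat n n yvar"


section \<open>The Weyl module and its character\<close>

definition weyl_generator :: "nat \<Rightarrow> (nat \<times> nat) set \<Rightarrow> (nat \<times> nat) set \<Rightarrow> ypoly" where
  "weyl_generator n D C = (\<Prod>j<n. det (submatrix (Ymat n) (column C j) (column D j)))"

definition weyl_module :: "nat \<Rightarrow> (nat \<times> nat) set \<Rightarrow> ypoly set" where
  "weyl_module n D = ypoly.span (weyl_generator n D ` same_column_sizes n D)"

text \<open>
  The action \<open>f(Y) \<cdot> g = f(g\<^sup>-\<^sup>1 Y)\<close>. It is meant for \<open>g \<in> Units (ring_mat TYPE(complex) n ())\<close>,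
  that is \<open>g \<in> GL\<^sub>n\<close>, and for \<open>f\<close> involving only the variables in \<open>Ymat n\<close>.
\<close>

definition gl_act :: "nat \<Rightarrow> ypoly \<Rightarrow> complex mat \<Rightarrow> ypoly" where
  "gl_act n f g =
     ysubst (($$) (map_mat yconst (inv\<^bsub>ring_mat TYPE(complex) n ()\<^esub> g) * Ymat n)) f"

text \<open>
  The trace of an endomorphism \<open>T\<close> of a finite-dimensional space \<open>V\<close> of polynomials; it does not
  depend on the basis, see \<open>trace_on_eq\<close> below.
\<close>

definition trace_on :: "ypoly set \<Rightarrow> (ypoly \<Rightarrow> ypoly) \<Rightarrow> complex" where
  "trace_on V T =
     (let B = (SOME B. ypoly.independent B \<and> ypoly.span B = V)
      in \<Sum>b\<in>B. ypoly.representation B (T b) b)"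

text \<open>
  Characters are functions of the diagonal entries and are meaningful when \<open>x i \<noteq> 0\<close> for all
  \<open>i < n\<close>. Equality of two characters as polynomials (or Laurent polynomials) is equality of
  these functions on the whole torus.
\<close>

definition gl_char :: "nat \<Rightarrow> ypoly set \<Rightarrow> (nat \<Rightarrow> complex) \<Rightarrow> complex" where
  "gl_char n N x = trace_on N (\<lambda>f. gl_act n f (mat_diag n x))"

definition dual_char :: "nat \<Rightarrow> ypoly set \<Rightarrow> (nat \<Rightarrow> complex) \<Rightarrow> complex" where
  "dual_char n N x = gl_char n N (\<lambda>i. inverse (x i))"

definition schur_char :: "nat \<Rightarrow> (nat \<times> nat) set \<Rightarrow> (nat \<Rightarrow> complex) \<Rightarrow> complex" where
  "schur_char n D = dual_char n (weyl_module n D)"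

lemma trace_on_eq:
  assumes B: "finite B" "ypoly.independent B" "ypoly.span B = V"
    and T: "\<And>f. f \<in> V \<Longrightarrow> T f \<in> V"
    and lin: "\<And>c d f g. f \<in> V \<Longrightarrow> g \<in> V \<Longrightarrow>
                T (yscale c f + yscale d g) = yscale c (T f) + yscale d (T g)"
  shows "trace_on V T = (\<Sum>b\<in>B. ypoly.representation B (T b) b)"
proof -
  define B' where "B' = (SOME B. ypoly.independent B \<and> ypoly.span B = V)"
  have B': "ypoly.independent B'" "ypoly.span B' = V"
    using someI[of "\<lambda>B. ypoly.independent B \<and> ypoly.span B = V" B] B by (auto simp: B'_def)
  have fin': "finite B'"
    using ypoly.independent_span_bound[OF B(1) B'(1)] B B' ypoly.span_superset by auto
  have sub: "ypoly.subspace V" using B(3) ypoly.subspace_span by blast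
  have in_V: "b \<in> V" if "b \<in> B \<union> B'" for b
    using that B(3) B'(2) ypoly.span_superset by auto
  have T0: "T 0 = 0" using lin[of 0 0 0 0] ypoly.subspace_0[OF sub] by simp
  have Tsum: "T (\<Sum>a\<in>A. yscale (c a) a) = (\<Sum>a\<in>A. yscale (c a) (T a))"
    if "finite A" "A \<subseteq> V" for A c
    using that
  proof (induction A rule: finite_induct)
    case empty
    then show ?case by (simp add: T0)
  next
    case (insert a A)
    have "(\<Sum>a\<in>A. yscale (c a) a) \<in> V"
      using insert by (intro ypoly.subspace_sum[OF sub] ypoly.subspace_scale[OF sub]) auto
    then show ?case using insert lin[of a "\<Sum>a\<in>A. yscale (c a) a" "c a" 1] by simp
  qed
  have expand: "(\<Sum>b\<in>E. yscale (ypoly.representation E v b) b) = v"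
    if "finite E" "ypoly.independent E" "ypoly.span E = V" "v \<in> V" for E v
    using ypoly.sum_representation_eq[of E v E] that by auto
  have rep: "ypoly.representation E (\<Sum>a\<in>A. yscale (c a) (h a)) e =
             (\<Sum>a\<in>A. c a * ypoly.representation E (h a) e)"
    if "ypoly.independent E" "ypoly.span E = V" "\<And>a. a \<in> A \<Longrightarrow> h a \<in> V"
    for E and A :: "ypoly set" and c h e
    using that
    by (subst ypoly.representation_sum)
       (auto intro!: sum.cong ypoly.span_scale simp: ypoly.representation_scale)
  have T_expand: "T b = (\<Sum>b'\<in>B'. yscale (ypoly.representation B' b b') (T b'))"
    if "b \<in> B" for b
  proof -
    have "T b = T (\<Sum>b'\<in>B'. yscale (ypoly.representation B' b b') b')"
      using expand[OF fin' B'] in_V that by simp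
    also have "\<dots> = (\<Sum>b'\<in>B'. yscale (ypoly.representation B' b b') (T b'))"
      using in_V by (intro Tsum[OF fin']) auto
    finally show ?thesis .
  qed
  have "(\<Sum>b\<in>B. ypoly.representation B (T b) b) =
        (\<Sum>b\<in>B. ypoly.representation B (\<Sum>b'\<in>B'. yscale (ypoly.representation B' b b') (T b')) b)"
    by (rule sum.cong[OF refl]) (use T_expand in presburger)
  also have "\<dots> = (\<Sum>b\<in>B. \<Sum>b'\<in>B'.
        ypoly.representation B' b b' * ypoly.representation B (T b') b)"
    using B in_V T by (intro sum.cong refl rep) auto
  also have "\<dots> = (\<Sum>b'\<in>B'. \<Sum>b\<in>B.
        ypoly.representation B (T b') b * ypoly.representation B' b b')"
    by (subst sum.swap) (simp add: mult.commute)
  also have "\<dots> = (\<Sum>b'\<in>B'. ypoly.representation B'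
        (\<Sum>b\<in>B. yscale (ypoly.representation B (T b') b) b) b')"
    using B' in_V by (intro sum.cong refl rep[symmetric]) auto
  also have "\<dots> = (\<Sum>b'\<in>B'. ypoly.representation B' (T b') b')"
    using expand[OF B] in_V T by (intro sum.cong refl) auto
  finally show ?thesis by (simp add: trace_on_def B'_def Let_def)
qed

end

theory Submission
  imports Defs "HOL-Library.Disjoint_Sets" "Jordan_Normal_Form.Char_Poly"
begin

text \<open>
  The generators of the Weyl module are weight vectors, the one for \<open>C\<close> having weight \<open>x\<^sup>C\<close> in the
  dual character. Hence the bound is attained iff the family of generators is linearly independent;
  evaluating the characters at \<open>x = 1\<close> gives one direction.

  Avoiding both configurations means that any two columns \<open>A, B\<close> of \<open>D\<close> are disjoint or cover
  \<open>[n]\<close>. Then the columns other than \<open>\<emptyset>\<close> and \<open>[n]\<close> are pairwise disjoint, or their complements are.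
  In the first case the minors involve disjoint sets of variables, and a suitable 0/1 matrix singles
  out one coefficient of a linear relation. The second case reduces to the first by Jacobi's
  complementary minor formula. Both the full columns and Jacobi's formula require an invertible
  matrix; this restriction is removed because \<open>det (M + t I)\<close> is a nonzero polynomial in \<open>t\<close>.

  Conversely, if \<open>A\<close> and \<open>B\<close> meet and do not cover \<open>[n]\<close>, take \<open>m = |A \<union> B| + 1 \<le> n\<close> rows and
  antisymmetrize over them a product of a minor in the columns \<open>A\<close> and a minor in the columns \<open>B\<close>,
  with rows that overlap in \<open>|A \<inter> B| - 1\<close> fixed positions. The result vanishes by the pigeonhole
  principle, and it is a nontrivial relation between the generators.
\<close>

section \<open>Substitution and the torus action\<close>

lemma yconst_simps [simp]: "yconst 0 = 0" "yconst 1 = 1"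
  by (simp_all add: yconst_def)

interpretation yconst: inj_comm_ring_hom yconst
  by unfold_locales
     (auto simp: yconst_def single_add mult_single dest: arg_cong[of _ _ "\<lambda>f. Poly_Mapping.lookup f 0"])

section \<open>Substitution as a ring homomorphism\<close>

definition ymonomial :: "(nat \<times> nat \<Rightarrow> ypoly) \<Rightarrow> ((nat \<times> nat) \<Rightarrow>\<^sub>0 nat) \<Rightarrow> ypoly" where
  "ymonomial \<sigma> m = (\<Prod>v\<in>Poly_Mapping.keys m. \<sigma> v ^ Poly_Mapping.lookup m v)"

text \<open>The additional factors are \<open>\<sigma> v ^ 0 = 1\<close>. A common index set makes
  monomials with different supports comparable.\<close>

lemma ymonomial_superset:
  assumes "finite K" "Poly_Mapping.keys m \<subseteq> K"
  shows "ymonomial \<sigma> m = (\<Prod>v\<in>K. \<sigma> v ^ Poly_Mapping.lookup m v)"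
  unfolding ymonomial_def using assms
  by (intro prod.mono_neutral_left) (auto simp: in_keys_iff)

lemma ymonomial_add: "ymonomial \<sigma> (m + m') = ymonomial \<sigma> m * ymonomial \<sigma> m'"
proof -
  let ?K = "Poly_Mapping.keys m \<union> Poly_Mapping.keys m'"
  have "Poly_Mapping.keys (m + m') \<subseteq> ?K"
    by (rule Poly_Mapping.keys_add)
  then show ?thesis
    by (simp add: ymonomial_superset[of ?K] lookup_add power_add prod.distrib)
qed

lemma ysubst_superset:
  assumes "finite K" "Poly_Mapping.keys f \<subseteq> K"
  shows "ysubst \<sigma> f = (\<Sum>m\<in>K. yconst (Poly_Mapping.lookup f m) * ymonomial \<sigma> m)"
  unfolding ysubst_def ymonomial_def using assms
  by (intro sum.mono_neutral_left) (auto simp: in_keys_iff)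

lemma ysubst_add: "ysubst \<sigma> (f + g) = ysubst \<sigma> f + ysubst \<sigma> g"
proof -
  let ?K = "Poly_Mapping.keys f \<union> Poly_Mapping.keys g"
  have "Poly_Mapping.keys (f + g) \<subseteq> ?K"
    by (rule Poly_Mapping.keys_add)
  then show ?thesis
    by (simp add: ysubst_superset[of ?K] lookup_add hom_distribs distrib_right sum.distrib)
qed

lemma ysubst_0 [simp]: "ysubst \<sigma> 0 = 0"
  by (simp add: ysubst_def)

lemma ysubst_sum: "ysubst \<sigma> (\<Sum>a\<in>A. h a) = (\<Sum>a\<in>A. ysubst \<sigma> (h a))"
  by (induction A rule: infinite_finite_induct) (simp_all add: ysubst_add)

lemma ysubst_single: "ysubst \<sigma> (Poly_Mapping.single m c) = yconst c * ymonomial \<sigma> m"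
  by (simp add: ysubst_superset[of "{m}"])

lemma ypoly_expand:
  fixes f :: ypoly
  shows "f = (\<Sum>m\<in>Poly_Mapping.keys f. Poly_Mapping.single m (Poly_Mapping.lookup f m))"
  by (rule poly_mapping_eqI)
     (simp add: lookup_sum lookup_single when_def in_keys_iff)

text \<open>Both sides are bilinear in \<open>f\<close> and \<open>g\<close>, so it suffices to
  treat single terms, whose exponents add.\<close>

lemma ysubst_mult: "ysubst \<sigma> (f * g) = ysubst \<sigma> f * ysubst \<sigma> g"
proof -
  define F where "F = (\<lambda>m. Poly_Mapping.single m (Poly_Mapping.lookup f m))"
  define G where "G = (\<lambda>m. Poly_Mapping.single m (Poly_Mapping.lookup g m))"
  have FG: "f = sum F (Poly_Mapping.keys f)" "g = sum G (Poly_Mapping.keys g)"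
    unfolding F_def G_def by (rule ypoly_expand)+
  have "ysubst \<sigma> (F m * G m') = ysubst \<sigma> (F m) * ysubst \<sigma> (G m')" for m m'
    by (simp add: F_def G_def mult_single ysubst_single ymonomial_add hom_distribs ac_simps)
  then have "ysubst \<sigma> (sum F (Poly_Mapping.keys f) * sum G (Poly_Mapping.keys g)) =
      ysubst \<sigma> (sum F (Poly_Mapping.keys f)) * ysubst \<sigma> (sum G (Poly_Mapping.keys g))"
    by (simp add: sum_product ysubst_sum)
  then show ?thesis
    by (simp flip: FG)
qed

lemma ysubst_yconst [simp]: "ysubst \<sigma> (yconst c) = yconst c"
  by (simp add: yconst_def ysubst_single ymonomial_def)

lemma ysubst_yvar [simp]: "ysubst \<sigma> (yvar v) = \<sigma> v"
  by (simp add: yvar_def ysubst_single ymonomial_def)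

interpretation ysubst: comm_ring_hom "ysubst \<sigma>"
  using ysubst_yconst[of \<sigma> 1] by unfold_locales (simp_all add: ysubst_add ysubst_mult)

lemma ysubst_yscale: "ysubst \<sigma> (yscale c f) = yscale c (ysubst \<sigma> f)"
  by (simp add: yscale_def ysubst_mult)

section \<open>Minors with prescribed row and column sets\<close>

lemma pick_less:
  assumes "I \<subseteq> {..<n}" "i < card I"
  shows "pick I i < n"
  using pick_in_set[of i I] assms by auto

lemma bij_betw_pick:
  assumes "finite I"
  shows "bij_betw (pick I) {..<card I} I"
proof -
  have "inj_on (pick I) {..<card I}"
    by (rule inj_onI) (metis card_pick lessThan_iff)
  moreover have "pick I ` {..<card I} \<subseteq> I"
    using pick_in_set by auto
  ultimately show ?thesis
    using assms by (simp add: bij_betw_def card_image card_subset_eq)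
qed

lemma submatrix_mat:
  assumes "I \<subseteq> {..<nr}" "J \<subseteq> {..<nc}"
  shows "submatrix (mat nr nc f) I J = mat (card I) (card J) (\<lambda>(i, j). f (pick I i, pick J j))"
proof -
  have *: "{i. i < nr \<and> i \<in> I} = I" "{i. i < nc \<and> i \<in> J} = J"
    using assms by auto
  show ?thesis
    using assms by (auto simp: submatrix_def * pick_less intro!: eq_matI)
qed

lemma submatrix_carrier:
  assumes "M \<in> carrier_mat nr nc" "I \<subseteq> {..<nr}" "J \<subseteq> {..<nc}"
  shows "submatrix M I J = mat (card I) (card J) (\<lambda>(i, j). M $$ (pick I i, pick J j))"
proof -
  have "M = mat nr nc (($$) M)"
    using assms by auto
  then show ?thesis
    using submatrix_mat[OF assms(2,3)] by metis
qed

text \<open>Every Leibniz term contains exactly one entry of each row.\<close>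

lemma det_scale_rows:
  "det (mat k k (\<lambda>(i, j). c i * f i j)) = (\<Prod>i<k. c i) * det (mat k k (\<lambda>(i, j). f i j))"
proof -
  have "(\<Prod>i = 0..<k. c i * f i (p i)) = (\<Prod>i<k. c i) * (\<Prod>i = 0..<k. f i (p i))" for p
    by (simp add: prod.distrib lessThan_atLeast0)
  then show ?thesis
    by (auto simp: det_def sum_distrib_left ac_simps intro!: sum.cong)
qed

lemma det_submatrix_scale_rows:
  assumes "I \<subseteq> {..<n}" "J \<subseteq> {..<n}" "card I = card J"
  shows "det (submatrix (mat n n (\<lambda>(i, j). c i * f i j)) I J) =
         (\<Prod>i\<in>I. c i) * det (submatrix (mat n n (\<lambda>(i, j). f i j)) I J)"
proof -
  have "finite I"
    using assms finite_subset by blast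
  then have "(\<Prod>i<card I. c (pick I i)) = (\<Prod>i\<in>I. c i)"
    using prod.reindex_bij_betw[OF bij_betw_pick] by blast
  then show ?thesis
    using assms det_scale_rows[of "card I" "\<lambda>i. c (pick I i)" "\<lambda>i j. f (pick I i) (pick J j)"]
    by (simp add: submatrix_mat)
qed

section \<open>Columns of diagrams\<close>

lemma column_subset: "D \<in> diagrams n \<Longrightarrow> column D j \<subseteq> {..<n}"
  by (auto simp: diagrams_def column_def)

lemma column_outside: "D \<in> diagrams n \<Longrightarrow> n \<le> j \<Longrightarrow> column D j = {}"
  by (auto simp: diagrams_def column_def)

lemma diagram_eqI: "(\<And>j. column C j = column C' j) \<Longrightarrow> C = C'"
  by (auto simp: column_def set_eq_iff)

lemma finite_same_column_sizes: "finite (same_column_sizes n D)"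
  by (rule finite_subset[of _ "diagrams n"]) (auto simp: same_column_sizes_def diagrams_def)

lemma same_column_sizesD:
  assumes "C \<in> same_column_sizes n D"
  shows "C \<in> diagrams n" "j < n \<Longrightarrow> card (column C j) = card (column D j)"
  using assms by (auto simp: same_column_sizes_def)

text \<open>A ring homomorphism commutes with determinants. This serves both for the torus action
  and for evaluating a relation at a complex matrix.\<close>

lemma ysubst_weyl_generator:
  assumes "C \<in> diagrams n" "D \<in> diagrams n"
  shows "ysubst \<sigma> (weyl_generator n D C) =
         (\<Prod>j<n. det (submatrix (mat n n \<sigma>) (column C j) (column D j)))"
proof -
  have "map_mat (ysubst \<sigma>) (submatrix (Ymat n) I J) = submatrix (mat n n \<sigma>) I J"
    if "I \<subseteq> {..<n}" "J \<subseteq> {..<n}" for I J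
    using that by (auto simp: Ymat_def submatrix_mat)
  then show ?thesis
    using assms by (simp add: weyl_generator_def hom_distribs column_subset flip: ysubst.hom_det)
qed

section \<open>Weights of the generators and the trace of the torus\<close>

lemma inv_ring_mat_eqI:
  fixes A B :: "complex mat"
  assumes "A \<in> carrier_mat n n" "B \<in> carrier_mat n n" "A * B = 1\<^sub>m n" "B * A = 1\<^sub>m n"
  shows "inv\<^bsub>ring_mat TYPE(complex) n ()\<^esub> A = B"
proof -
  interpret R: ring "ring_mat TYPE(complex) n ()"
    by (rule ring_mat)
  show ?thesis
    by (rule R.inv_unique'[symmetric]) (use assms in \<open>auto simp: ring_mat_simps\<close>)
qed

text \<open>The dual character inverts the diagonal entries and the action inverts them again, so
  row \<open>i\<close> of \<open>Ymat n\<close> is scaled by \<open>x i\<close> itself. The minor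
  with rows \<open>column C j\<close> then gains the product of \<open>x i\<close> over these
  rows.\<close>

lemma gl_act_torus:
  assumes "\<forall>i<n. x i \<noteq> 0" "C \<in> same_column_sizes n D" "D \<in> diagrams n"
  shows "gl_act n (weyl_generator n D C) (mat_diag n (\<lambda>i. inverse (x i))) =
         yscale (diagram_monomial n x C) (weyl_generator n D C)"
proof -
  note C = same_column_sizesD[OF assms(2)]
  have diag: "mat_diag n (\<lambda>i. inverse (x i) * x i) = 1\<^sub>m n"
    using assms(1) by (auto simp: mat_diag_def)
  have "inv\<^bsub>ring_mat TYPE(complex) n ()\<^esub> (mat_diag n (\<lambda>i. inverse (x i))) = mat_diag n x"
    by (rule inv_ring_mat_eqI) (use diag in \<open>simp_all add: mult.commute\<close>)
  moreover have "map_mat yconst (mat_diag n x) * Ymat n =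
      mat n n (\<lambda>(i, j). yconst (x i) * yvar (i, j))"
  proof -
    have "map_mat yconst (mat_diag n x) = mat_diag n (\<lambda>i. yconst (x i))"
      by (auto simp: mat_diag_def)
    then show ?thesis
      by (auto simp: mat_diag_mult_left[of _ n n] Ymat_def)
  qed
  ultimately have "gl_act n (weyl_generator n D C) (mat_diag n (\<lambda>i. inverse (x i))) =
      (\<Prod>j<n. det (submatrix (mat n n (($$) (mat n n (\<lambda>(i, j). yconst (x i) * yvar (i, j)))))
        (column C j) (column D j)))"
    by (simp add: gl_act_def ysubst_weyl_generator[OF C(1) assms(3)])
  also have "mat n n (($$) (mat n n (\<lambda>(i, j). yconst (x i) * yvar (i, j)))) =
      mat n n (\<lambda>(i, j). yconst (x i) * yvar (i, j))"
    by auto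
  also have "(\<Prod>j<n. det (submatrix (mat n n (\<lambda>(i, j). yconst (x i) * yvar (i, j)))
        (column C j) (column D j))) =
      (\<Prod>j<n. (\<Prod>i\<in>column C j. yconst (x i)) * det (submatrix (Ymat n) (column C j) (column D j)))"
    using C assms(3)
    by (intro prod.cong refl)
       (simp add: det_submatrix_scale_rows column_subset Ymat_def)
  also have "\<dots> = yscale (diagram_monomial n x C) (weyl_generator n D C)"
    by (simp add: yscale_def diagram_monomial_def weyl_generator_def prod.distrib hom_distribs)
  finally show ?thesis .
qed

text \<open>In a basis of generators the torus acts diagonally, so the trace is the sum of the
  weights. The weight \<open>w\<close> depends on the basis vector, since different diagrams might
  give the same generator.\<close>

lemma schur_char_eq_basis_sum:
  assumes "B \<subseteq> weyl_generator n D ` same_column_sizes n D" "ypoly.independent B"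
    "ypoly.span B = weyl_module n D" "D \<in> diagrams n" "\<forall>i<n. x i \<noteq> 0"
    and wt: "\<And>C. C \<in> same_column_sizes n D \<Longrightarrow> weyl_generator n D C \<in> B \<Longrightarrow>
               w (weyl_generator n D C) = diagram_monomial n x C"
  shows "schur_char n D x = (\<Sum>b\<in>B. w b)"
proof -
  define T where "T = (\<lambda>f. gl_act n f (mat_diag n (\<lambda>i. inverse (x i))))"
  have T_comb: "T (yscale c f + yscale d g) = yscale c (T f) + yscale d (T g)" for c d f g
    by (simp add: T_def gl_act_def ysubst_add ysubst_yscale)
  have T_gen: "T (weyl_generator n D C) = yscale (diagram_monomial n x C) (weyl_generator n D C)"
    if "C \<in> same_column_sizes n D" for C
    using gl_act_torus[OF assms(5) that assms(4)] by (simp add: T_def)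
  have T0: "T 0 = 0"
    using T_comb[of 0 0 0 0] by simp
  have T_in: "T f \<in> weyl_module n D" if "f \<in> weyl_module n D" for f
    using that unfolding weyl_module_def
  proof (induction rule: ypoly.span_induct_alt)
    case base
    then show ?case by (simp add: T0 ypoly.span_zero)
  next
    case (step c f g)
    then have "T f \<in> ypoly.span (weyl_generator n D ` same_column_sizes n D)"
      using T_gen by (auto simp: ypoly.span_base ypoly.span_scale)
    then show ?case
      using T_comb[of c f 1 g] step by (simp add: ypoly.span_add ypoly.span_scale)
  qed
  have "finite B"
    using assms(1) finite_same_column_sizes finite_subset by blast
  then have "schur_char n D x = (\<Sum>b\<in>B. ypoly.representation B (T b) b)"
    unfolding schur_char_def dual_char_def gl_char_def T_def[symmetric]
    using assms(2,3) T_in T_comb by (intro trace_on_eq)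
  also have "\<dots> = (\<Sum>b\<in>B. w b)"
  proof (rule sum.cong[OF refl])
    fix b
    assume "b \<in> B"
    then obtain C where C: "C \<in> same_column_sizes n D" "b = weyl_generator n D C"
      using assms(1) by blast
    then show "ypoly.representation B (T b) b = w b"
      using T_gen[OF C(1)] wt[OF C(1)] \<open>b \<in> B\<close> assms(2)
      by (simp add: ypoly.representation_scale ypoly.span_base ypoly.representation_basis)
  qed
  finally show ?thesis .
qed

section \<open>Independence of minors in disjoint or codisjoint columns\<close>

lemma det_zero_row:
  assumes "i < k" "\<And>j. j < k \<Longrightarrow> f i j = 0"
  shows "det (mat k k (\<lambda>(i, j). f i j)) = 0"
proof -
  have "(\<Prod>l = 0..<k. f l (p l)) = 0" if "p permutes {0..<k}" for p
    using assms permutes_in_image[OF that, of i] by (intro prod_zero bexI[of _ i]) auto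
  then show ?thesis
    by (simp add: det_def)
qed

text \<open>Along the line \<open>M + t I\<close> the sum is a polynomial \<open>q\<close> in
  \<open>t\<close> that vanishes wherever \<open>det (M + t I)\<close> does not. Its product with
  this nonzero polynomial is therefore zero, so \<open>q = 0\<close>; take
  \<open>t = 0\<close>.\<close>

lemma minor_sum_zero_singular:
  fixes lam :: "'b \<Rightarrow> complex"
  assumes "\<And>C j. C \<in> S \<Longrightarrow> j \<in> J \<Longrightarrow> R C j \<subseteq> {..<n} \<and> K C j \<subseteq> {..<n} \<and> card (R C j) = card (K C j)"
    and "\<And>M. M \<in> carrier_mat n n \<Longrightarrow> det M \<noteq> 0 \<Longrightarrow>
           (\<Sum>C\<in>S. lam C * (\<Prod>j\<in>J. det (submatrix M (R C j) (K C j)))) = 0"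
    and M: "M \<in> carrier_mat n n"
  shows "(\<Sum>C\<in>S. lam C * (\<Prod>j\<in>J. det (submatrix M (R C j) (K C j)))) = 0"
proof -
  define P where "P = mat n n (\<lambda>(i, j). [:M $$ (i, j), if i = j then 1 else 0:])"
  define N where "N = (\<lambda>t. mat n n (\<lambda>(i, j). M $$ (i, j) + (if i = j then t else 0)))"
  define q where "q = (\<Sum>C\<in>S. smult (lam C) (\<Prod>j\<in>J. det (submatrix P (R C j) (K C j))))"
  have det_P: "poly (det P) t = det (N t)" for t
    by (rule poly_det_cong[of _ n]) (auto simp: P_def N_def)
  have q: "poly q t = (\<Sum>C\<in>S. lam C * (\<Prod>j\<in>J. det (submatrix (N t) (R C j) (K C j))))" for t
    unfolding q_def poly_sum poly_smult poly_prod
  proof (intro sum.cong refl arg_cong2[of _ _ _ _ "(*)"] prod.cong)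
    fix C j
    assume "C \<in> S" "j \<in> J"
    note RK = assms(1)[OF this]
    then show "poly (det (submatrix P (R C j) (K C j))) t = det (submatrix (N t) (R C j) (K C j))"
      by (intro poly_det_cong[of _ "card (R C j)"])
         (auto simp: P_def N_def submatrix_mat pick_less)
  qed
  \<comment> \<open>\<open>P\<close> is \<open>t I - (- M)\<close>, so its determinant is monic of
    degree \<open>n\<close>.\<close>
  have "char_poly (- M) = det P"
    unfolding char_poly_def
    by (rule arg_cong[of _ _ det]) (use M in \<open>auto simp: char_poly_matrix_def P_def\<close>)
  then have "coeff (det P) n = 1"
    using degree_monic_char_poly[of "- M" n] M by simp
  then have "det P \<noteq> 0"
    by auto
  have "poly (det P * q) t = 0" for t
    using assms(2)[of "N t"] by (cases "det (N t) = 0") (auto simp: q det_P N_def)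
  then have "det P * q = 0"
    using poly_all_0_iff_0 by blast
  then have "q = 0"
    using \<open>det P \<noteq> 0\<close> by simp
  moreover have "N 0 = M"
    using M by (auto simp: N_def)
  ultimately show ?thesis
    using q[of 0] by simp
qed

text \<open>As the sets \<open>E j\<close> are disjoint, one 0/1 matrix can place an identity block
  in the rows \<open>F C0 j\<close> and columns \<open>E j\<close> for all \<open>j\<close> at once.
  Evaluated there, every product except the one for \<open>C0\<close> vanishes.\<close>

lemma disjoint_minors_independent:
  fixes lam :: "'b \<Rightarrow> complex"
  assumes "finite S" "finite J" "disjoint_family_on E J"
    and E: "\<And>j. j \<in> J \<Longrightarrow> E j \<subseteq> {..<n}"
    and F: "\<And>C j. C \<in> S \<Longrightarrow> j \<in> J \<Longrightarrow> F C j \<subseteq> {..<n} \<and> card (F C j) = card (E j)"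
    and inj: "\<And>C C'. C \<in> S \<Longrightarrow> C' \<in> S \<Longrightarrow> (\<And>j. j \<in> J \<Longrightarrow> F C j = F C' j) \<Longrightarrow> C = C'"
    and rel: "\<And>M. M \<in> carrier_mat n n \<Longrightarrow> det M \<noteq> 0 \<Longrightarrow>
           (\<Sum>C\<in>S. lam C * (\<Prod>j\<in>J. det (submatrix M (F C j) (E j)))) = 0"
    and C0: "C0 \<in> S"
  shows "lam C0 = 0"
proof -
  \<comment> \<open>The cardinality is the position of \<open>c\<close> within \<open>E j\<close>.
    The row sets \<open>F C0 j\<close> may overlap for different \<open>j\<close>, so this matrix
    can be singular.\<close>
  define M :: "complex mat" where
    "M = mat n n (\<lambda>(i, c). if \<exists>j\<in>J. c \<in> E j \<and> i = pick (F C0 j) (card {a\<in>E j. a < c}) then 1 else 0)"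
  have entry: "M $$ (i, pick (E j) k) = (if i = pick (F C0 j) k then 1 else 0)"
    if "j \<in> J" "k < card (E j)" "i < n" for i j k
  proof -
    have "pick (E j) k \<in> E j"
      using that by (simp add: pick_in_set)
    then have "j' = j" if "j' \<in> J" "pick (E j) k \<in> E j'" for j'
      using assms(3) \<open>j \<in> J\<close> that by (auto simp: disjoint_family_on_def)
    then have "(\<exists>j'\<in>J. pick (E j) k \<in> E j' \<and> Q j') \<longleftrightarrow> Q j" for Q
      using \<open>pick (E j) k \<in> E j\<close> \<open>j \<in> J\<close> by blast
    then show ?thesis
      using that E by (simp add: M_def card_pick pick_less)
  qed
  have sub: "submatrix M (F C j) (E j) =
      mat (card (E j)) (card (E j)) (\<lambda>(i, k). if pick (F C j) i = pick (F C0 j) k then 1 else 0)"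
    if "C \<in> S" "j \<in> J" for C j
    using F[OF that] E[OF that(2)] that entry pick_less
    by (subst submatrix_carrier[of _ n n]) (auto simp: M_def[symmetric], simp add: M_def)
  have det_sub: "det (submatrix M (F C j) (E j)) = (if F C j = F C0 j then 1 else 0)"
    if CJ: "C \<in> S" "j \<in> J" for C j
  proof (cases "F C j = F C0 j")
    case True
    have "inj_on (pick (F C0 j)) {..<card (E j)}"
      using bij_betw_pick[of "F C0 j"] F[OF C0 CJ(2)] finite_subset
      by (auto simp: bij_betw_def)
    then have "submatrix M (F C j) (E j) = 1\<^sub>m (card (E j))"
      unfolding True by (auto simp: sub[OF C0 CJ(2)] inj_on_eq_iff intro!: eq_matI)
    then show ?thesis
      using True by simp
  next
    case False
    have fin: "finite (F C j)" "finite (F C0 j)"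
      using F[OF CJ] F[OF C0 CJ(2)] finite_subset by blast+
    \<comment> \<open>The two sets have equal size, so the first is not contained in the second. Row
      \<open>r\<close> of \<open>M\<close> is zero in the columns \<open>E j\<close>.\<close>
    then obtain r where r: "r \<in> F C j" "r \<notin> F C0 j"
      using False F[OF CJ] F[OF C0 CJ(2)] card_subset_eq[of "F C0 j" "F C j"] by auto
    then obtain i where i: "i < card (E j)" "r = pick (F C j) i"
      using bij_betw_pick[OF fin(1)] F[OF CJ] by (auto simp: bij_betw_def)
    have "r \<noteq> pick (F C0 j) k" if "k < card (E j)" for k
      using r(2) pick_in_set[of k "F C0 j"] F[OF C0 CJ(2)] that by auto
    then show ?thesis
      using False i by (auto simp: sub[OF CJ] intro!: det_zero_row[of i])
  qed
  \<comment> \<open>The relation is assumed for invertible matrices only and has to be extended to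
    this \<open>M\<close>.\<close>
  have "0 = (\<Sum>C\<in>S. lam C * (\<Prod>j\<in>J. det (submatrix M (F C j) (E j))))"
    by (rule minor_sum_zero_singular[symmetric, of _ _ _ n]) (use E F rel in \<open>auto simp: M_def\<close>)
  also have "\<dots> = (\<Sum>C\<in>S. if C = C0 then lam C else 0)"
  proof (rule sum.cong[OF refl])
    fix C
    assume C: "C \<in> S"
    show "lam C * (\<Prod>j\<in>J. det (submatrix M (F C j) (E j))) = (if C = C0 then lam C else 0)"
    proof (cases "C = C0")
      case True
      then show ?thesis
        using C by (simp add: det_sub)
    next
      case False
      then obtain j where "j \<in> J" "F C j \<noteq> F C0 j"
        using inj[OF C C0] by blast
      then have "(\<Prod>j\<in>J. det (submatrix M (F C j) (E j))) = 0"
        using C det_sub[of C j] \<open>finite J\<close> by (intro prod_zero) auto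
      then show ?thesis
        using False by simp
    qed
  qed
  also have "\<dots> = lam C0"
    using \<open>finite S\<close> C0 by simp
  finally show ?thesis
    by simp
qed

section \<open>Jacobi's complementary minor formula\<close>

lemma det_permute_rows_cols:
  assumes "p permutes {..<n}" "q permutes {..<n}"
  shows "det (mat n n (\<lambda>(i, j). M $$ (p i, q j))) =
         signof p * (signof q * det (mat n n (\<lambda>(i, j). M $$ (i, j))))"
proof -
  have lt: "p i < n" "q i < n" if "i < n" for i
    using that permutes_in_image[OF assms(1)] permutes_in_image[OF assms(2)] by auto
  let ?N = "mat n n (\<lambda>(i, j). M $$ (i, j))"
  let ?Q = "mat n n (\<lambda>(i, j). M $$ (i, q j))"
  have "det (mat n n (\<lambda>(i, j). M $$ (p i, q j))) = det (mat n n (\<lambda>(i, j). ?Q $$ (p i, j)))"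
    using lt by (intro arg_cong[of _ _ det]) auto
  also have "\<dots> = signof p * det ?Q"
    using assms(1) by (intro det_permute_rows) (simp_all add: lessThan_atLeast0)
  also have "det ?Q = det (mat n n (\<lambda>(i, j). transpose_mat ?N $$ (q i, j)))"
    by (subst det_transpose[symmetric, of _ n]) (use lt in \<open>auto intro!: arg_cong[of _ _ det]\<close>)
  also have "\<dots> = signof q * det (transpose_mat ?N)"
    using assms(2) by (intro det_permute_rows) (simp_all add: lessThan_atLeast0)
  also have "det (transpose_mat ?N) = det ?N"
    by (rule det_transpose[of _ n]) simp
  finally show ?thesis .
qed

text \<open>Listing \<open>A\<close> in increasing order and then its complement moves a minor into
  the upper left corner and the complementary minor into the lower right one.\<close>

lemma subset_first_permutation:
  assumes "A \<subseteq> {..<n}"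
  obtains p where "p permutes {..<n}" "\<And>i. i < card A \<Longrightarrow> p i = pick A i"
    "\<And>i. i < n - card A \<Longrightarrow> p (i + card A) = pick ({..<n} - A) i"
proof -
  let ?a = "card A"
  have fin: "finite A" "finite ({..<n} - A)"
    using assms finite_subset by blast+
  have card_le: "?a \<le> n" and card_diff: "card ({..<n} - A) = n - ?a"
    using assms card_mono[OF _ assms] by (simp_all add: card_Diff_subset fin)
  define p where "p = (\<lambda>i. if i < ?a then pick A i else if i < n then pick ({..<n} - A) (i - ?a) else i)"
  have 1: "bij_betw p {..<?a} A"
    using bij_betw_pick[OF fin(1)] by (rule bij_betw_cong[THEN iffD1, rotated]) (simp add: p_def)
  have "bij_betw (\<lambda>i. i - ?a) {?a..<n} {..<n - ?a}"
    using card_le by (intro bij_betw_byWitness[of _ "\<lambda>i. i + ?a"]) auto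
  from bij_betw_trans[OF this] bij_betw_pick[OF fin(2)]
  have "bij_betw (pick ({..<n} - A) \<circ> (\<lambda>i. i - ?a)) {?a..<n} ({..<n} - A)"
    by (simp add: card_diff)
  then have 2: "bij_betw p {?a..<n} ({..<n} - A)"
    by (rule bij_betw_cong[THEN iffD1, rotated]) (simp add: p_def)
  have "{..<?a} \<union> {?a..<n} = {..<n}" "A \<union> ({..<n} - A) = {..<n}"
    using assms card_le by auto
  then have "bij_betw p {..<n} {..<n}"
    using bij_betw_combine[OF 1 2] by auto
  then have "p permutes {..<n}"
    by (rule bij_imp_permutes) (use card_le in \<open>auto simp: p_def\<close>)
  then show ?thesis
    by (rule that) (auto simp: p_def)
qed

text \<open>With the rows \<open>I\<close> and columns \<open>J\<close> of \<open>M\<close> moved to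
  the front, multiply \<open>M\<close> by the correspondingly permuted inverse, whose first block
  column is replaced by that of the identity. The product is block lower triangular; compare
  determinants. The scalar \<open>s\<close> is a sign that depends on \<open>I\<close> and
  \<open>J\<close> but not on the matrices.\<close>

lemma jacobi_complementary_minor:
  assumes "I \<subseteq> {..<n}" "J \<subseteq> {..<n}" "card I = card J"
  shows "\<exists>s :: complex. s \<noteq> 0 \<and>
    (\<forall>M N. M \<in> carrier_mat n n \<longrightarrow> N \<in> carrier_mat n n \<longrightarrow> M * N = 1\<^sub>m n \<longrightarrow>
       det (submatrix M I J) = s * det M * det (submatrix N ({..<n} - J) ({..<n} - I)))"
proof -
  define a where "a = card I"
  define b where "b = n - a"
  have fin: "finite I" "finite J"
    using assms finite_subset by blast+
  have ab: "n = a + b"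
    using card_mono[OF _ assms(1)] by (simp add: a_def b_def)
  have compl: "card ({..<n} - I) = b" "card ({..<n} - J) = b"
    using assms by (simp_all add: card_Diff_subset fin a_def b_def)
  obtain p where p: "p permutes {..<n}" "\<And>i. i < a \<Longrightarrow> p i = pick I i"
    "\<And>i. i < b \<Longrightarrow> p (i + a) = pick ({..<n} - I) i"
    using subset_first_permutation[OF assms(1)] by (metis a_def b_def)
  obtain q where q: "q permutes {..<n}" "\<And>i. i < a \<Longrightarrow> q i = pick J i"
    "\<And>i. i < b \<Longrightarrow> q (i + a) = pick ({..<n} - J) i"
    using subset_first_permutation[OF assms(2)] by (metis a_def b_def assms(3))
  have lt: "p i < n" "q i < n" if "i < n" for i
    using that permutes_in_image[OF p(1)] permutes_in_image[OF q(1)] by auto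
  show ?thesis
  proof (intro exI[of _ "signof p * signof q"] conjI allI impI)
    show "signof p * signof q \<noteq> (0 :: complex)"
      by (cases p rule: sign_cases; cases q rule: sign_cases) simp_all
    fix M N :: "complex mat"
    assume M: "M \<in> carrier_mat n n" and N: "N \<in> carrier_mat n n" and MN: "M * N = 1\<^sub>m n"
    have M_eq: "mat n n (($$) M) = M"
      using M by auto
    \<comment> \<open>These are the blocks with upper left corner \<open>(r0, c0)\<close>. The roles
      of \<open>p\<close> and \<open>q\<close> are exchanged in \<open>Q\<close>, because the rows
      of \<open>N\<close> correspond to the columns of \<open>M\<close>.\<close>
    define P where "P r0 c0 r c = mat r c (\<lambda>(i, j). M $$ (p (i + r0), q (j + c0)))" for r0 c0 r c
    define Q where "Q r0 c0 r c = mat r c (\<lambda>(i, j). N $$ (q (i + r0), p (j + c0)))" for r0 c0 r c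
    have carr: "P r0 c0 r c \<in> carrier_mat r c" "Q r0 c0 r c \<in> carrier_mat r c" for r0 c0 r c
      by (simp_all add: P_def Q_def)
    have prod: "(\<Sum>k<n. M $$ (p i, q k) * N $$ (q k, p j)) = (if i = j then 1 else 0)"
      if "i < n" "j < n" for i j
    proof -
      have "(\<Sum>k<n. M $$ (p i, q k) * N $$ (q k, p j)) = (\<Sum>k<n. M $$ (p i, k) * N $$ (k, p j))"
        by (rule sum.reindex_bij_betw[of q]) (use permutes_imp_bij[OF q(1)] in simp)
      also have "\<dots> = (M * N) $$ (p i, p j)"
        using M N lt that by (auto simp: scalar_prod_def lessThan_atLeast0)
      also have "\<dots> = (if i = j then 1 else 0)"
        using lt that permutes_inj[OF p(1)] by (auto simp: MN inj_eq)
      finally show ?thesis .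
    qed
    \<comment> \<open>Rows \<open>r0\<close> to \<open>r0 + r - 1\<close> of the permuted product,
      restricted to its last \<open>b\<close> columns.\<close>
    have block: "P r0 0 r a * Q 0 a a b + P r0 a r b * Q a a b b =
        mat r b (\<lambda>(i, j). if i + r0 = j + a then 1 else 0)" if "r0 + r \<le> n" for r0 r
    proof (rule eq_matI)
      fix i j
      assume "i < dim_row (mat r b (\<lambda>(i, j). if i + r0 = j + a then 1 else 0 :: complex))"
        "j < dim_col (mat r b (\<lambda>(i, j). if i + r0 = j + a then 1 else 0 :: complex))"
      then have ij: "i < r" "j < b"
        by simp_all
      let ?f = "\<lambda>k. M $$ (p (i + r0), q k) * N $$ (q k, p (j + a))"
      have "(P r0 0 r a * Q 0 a a b + P r0 a r b * Q a a b b) $$ (i, j) =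
          (\<Sum>k<a. ?f k) + (\<Sum>k<b. ?f (k + a))"
        using ij by (simp add: P_def Q_def scalar_prod_def lessThan_atLeast0)
      also have "(\<Sum>k<b. ?f (k + a)) = (\<Sum>k\<in>{a..<n}. ?f k)"
        using sum.shift_bounds_nat_ivl[of ?f 0 a b] ab by (simp add: lessThan_atLeast0 add.commute)
      also have "(\<Sum>k<a. ?f k) + (\<Sum>k\<in>{a..<n}. ?f k) = (\<Sum>k<n. ?f k)"
        using sum.atLeastLessThan_concat[of 0 a n ?f] ab by (simp add: lessThan_atLeast0)
      finally show "(P r0 0 r a * Q 0 a a b + P r0 a r b * Q a a b b) $$ (i, j) =
          mat r b (\<lambda>(i, j). if i + r0 = j + a then 1 else 0) $$ (i, j)"
        using ij prod[of "i + r0" "j + a"] that ab by simp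
    qed (simp_all add: P_def Q_def)
    have upper: "P 0 0 a a * Q 0 a a b + P 0 a a b * Q a a b b = 0\<^sub>m a b"
      using block[of 0 a] ab by auto
    have lower: "P a 0 b a * Q 0 a a b + P a a b b * Q a a b b = 1\<^sub>m b"
      using block[of a b] ab by auto
    let ?M' = "four_block_mat (P 0 0 a a) (P 0 a a b) (P a 0 b a) (P a a b b)"
    let ?N' = "four_block_mat (1\<^sub>m a) (Q 0 a a b) (0\<^sub>m b a) (Q a a b b)"
    have "?M' * ?N' = four_block_mat (P 0 0 a a) (0\<^sub>m a b) (P a 0 b a) (1\<^sub>m b)"
      by (subst mult_four_block_mat[of _ a a _ b _ b _ _ a _ b])
         (simp_all add: carr upper lower right_mult_one_mat[OF carr(1)]
            right_mult_zero_mat[OF carr(1)] right_add_zero_mat[OF carr(1)])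
    then have "det (P 0 0 a a) = det (?M' * ?N')"
      using det_four_block_mat_upper_right_zero[OF carr(1) refl carr(1) one_carrier_mat] by simp
    also have "\<dots> = det ?M' * det ?N'"
      by (rule det_mult[of _ n]) (use carr ab in \<open>auto intro!: four_block_carrier_mat\<close>)
    also have "det ?N' = det (Q a a b b)"
      using det_four_block_mat_lower_left_zero[OF one_carrier_mat carr(2) refl carr(2)] by simp
    also have "?M' = mat n n (\<lambda>(i, j). M $$ (p i, q j))"
      by (rule eq_matI) (auto simp: P_def ab)
    also have "det \<dots> = signof p * (signof q * det M)"
      using det_permute_rows_cols[OF p(1) q(1), of M] by (simp add: M_eq)
    also have "P 0 0 a a = submatrix M I J"
      by (rule eq_matI)
         (auto simp: submatrix_carrier[OF M assms(1,2)] a_def assms(3) P_def p(2)[unfolded a_def] q(2)[unfolded a_def assms(3)])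
    also have "Q a a b b = submatrix N ({..<n} - J) ({..<n} - I)"
      by (rule eq_matI) (auto simp: submatrix_carrier[OF N] compl Q_def p(3) q(3))
    finally show "det (submatrix M I J) =
        signof p * signof q * det M * det (submatrix N ({..<n} - J) ({..<n} - I))"
      by (simp add: ac_simps)
  qed
qed

section \<open>Independence of the generators\<close>

lemma submatrix_full:
  assumes "M \<in> carrier_mat n n"
  shows "submatrix M {..<n} {..<n} = M"
proof -
  have "pick {..<n} i = i" if "i < n" for i
    using pick_reduce_set[of i n UNIV] that by (simp add: pick_UNIV lessThan_def)
  then show ?thesis
    using assms by (subst submatrix_carrier) (auto intro!: eq_matI)
qed

text \<open>Otherwise some pair \<open>i, j\<close> meets and some pair \<open>k, l\<close> does not
  cover \<open>X\<close>, so \<open>A k\<close> and \<open>A l\<close> are disjoint. Every other set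
  misses both of these, so \<open>i, j\<close> are other indices; they cover \<open>X\<close>, yet
  both miss the nonempty \<open>A k\<close>.\<close>

lemma disjoint_or_codisjoint:
  assumes "\<And>i j. i \<in> J \<Longrightarrow> j \<in> J \<Longrightarrow> i \<noteq> j \<Longrightarrow> A i \<inter> A j = {} \<or> A i \<union> A j = X"
    and "\<And>j. j \<in> J \<Longrightarrow> A j \<subseteq> X" "\<And>j. j \<in> J \<Longrightarrow> A j \<noteq> {}" "\<And>j. j \<in> J \<Longrightarrow> A j \<noteq> X"
  shows "disjoint_family_on A J \<or> disjoint_family_on (\<lambda>j. X - A j) J"
proof (rule ccontr)
  assume "\<not> ?thesis"
  then have *: "\<not> disjoint_family_on A J" "\<not> disjoint_family_on (\<lambda>j. X - A j) J"
    by blast+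
  obtain i j where ij: "i \<in> J" "j \<in> J" "i \<noteq> j" "A i \<inter> A j \<noteq> {}"
    using *(1) by (auto simp: disjoint_family_on_def)
  obtain k l where kl: "k \<in> J" "l \<in> J" "k \<noteq> l" "(X - A k) \<inter> (X - A l) \<noteq> {}"
    using *(2) unfolding disjoint_family_on_def by metis
  have disj: "A k \<inter> A l = {}"
    using assms(1)[of k l] kl assms(2)[of k] assms(2)[of l] by blast
  \<comment> \<open>If \<open>A m\<close> meets \<open>A k\<close>, it covers \<open>X\<close> with \<open>A k\<close>, so it contains \<open>A l\<close>; but then it covers
    \<open>X\<close> with \<open>A l\<close> as well, so it is all of \<open>X\<close>.\<close>
  have meet: "A m \<inter> A k = {}" if "m \<in> J" "m \<noteq> k" "m \<noteq> l" for m
    using assms(1)[of m k] assms(1)[of m l] assms(1)[of k l] assms(2-4)[of m] assms(2-4)[of k] assms(2-4)[of l] kl that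
    by blast
  have meet': "A m \<inter> A l = {}" if "m \<in> J" "m \<noteq> k" "m \<noteq> l" for m
    using assms(1)[of m k] assms(1)[of m l] assms(1)[of k l] assms(2-4)[of m] assms(2-4)[of k] assms(2-4)[of l] kl that
    by blast
  have "i \<noteq> k \<or> j \<noteq> l" "i \<noteq> l \<or> j \<noteq> k"
    using disj ij(4) by blast+
  then have "i \<notin> {k, l}" "j \<notin> {k, l}"
    using meet[of i] meet[of j] meet'[of i] meet'[of j] ij by blast+
  moreover have "A i \<union> A j = X"
    using assms(1)[of i j] ij by blast
  ultimately show False
    using meet[of i] meet[of j] assms(2,3)[of k] ij(1,2) kl(1) by blast
qed

lemma weyl_generators_independent:
  assumes D: "D \<in> diagrams n" and avoid: "\<not> has_first_configuration n D" "\<not> has_second_configuration n D"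
    and rel: "(\<Sum>C\<in>same_column_sizes n D. yscale (lam C) (weyl_generator n D C)) = 0"
    and C0: "C0 \<in> same_column_sizes n D"
  shows "lam C0 = 0"
proof -
  let ?S = "same_column_sizes n D"
  \<comment> \<open>In an empty or full column the cardinality condition leaves \<open>C\<close> no
    choice.\<close>
  define J where "J = {j. j < n \<and> column D j \<noteq> {} \<and> column D j \<noteq> {..<n}}"
  have trivial: "column C j = column D j" if "C \<in> ?S" "j \<notin> J" for C j
  proof (cases "j < n")
    case True
    note C = column_subset[OF same_column_sizesD(1)[OF that(1)], of j]
    have "finite (column C j)"
      using C finite_subset by blast
    then show ?thesis
      using True same_column_sizesD(2)[OF that(1) True] that(2) C card_subset_eq[of "{..<n}" "column C j"]
      by (auto simp: J_def)
  next
    case False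
    then show ?thesis
      using column_outside same_column_sizesD(1)[OF that(1)] D by simp
  qed
  have inj: "C = C'" if "C \<in> ?S" "C' \<in> ?S" "\<And>j. j \<in> J \<Longrightarrow> column C j = column C' j" for C C'
  proof (rule diagram_eqI)
    fix j
    show "column C j = column C' j"
      using that trivial[of C j] trivial[of C' j] by (cases "j \<in> J") simp_all
  qed
  have rel_all: "(\<Sum>C\<in>?S. lam C * (\<Prod>j<n. det (submatrix M (column C j) (column D j)))) = 0"
    if M: "M \<in> carrier_mat n n" for M
  proof -
    have sub: "submatrix (mat n n (\<lambda>v. yconst (M $$ v))) I K = map_mat yconst (submatrix M I K)"
      if "I \<subseteq> {..<n}" "K \<subseteq> {..<n}" for I K
      using that by (auto simp: submatrix_mat submatrix_carrier[OF M])
    have "ysubst (\<lambda>v. yconst (M $$ v)) (weyl_generator n D C) =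
        yconst (\<Prod>j<n. det (submatrix M (column C j) (column D j)))" if "C \<in> ?S" for C
      using same_column_sizesD(1)[OF that] D
      by (simp add: ysubst_weyl_generator sub column_subset hom_distribs yconst.hom_det)
    then have "yconst (\<Sum>C\<in>?S. lam C * (\<Prod>j<n. det (submatrix M (column C j) (column D j)))) =
        ysubst (\<lambda>v. yconst (M $$ v)) (\<Sum>C\<in>?S. yscale (lam C) (weyl_generator n D C))"
      by (simp add: ysubst_sum ysubst_yscale yscale_def hom_distribs)
    then show ?thesis
      by (simp add: rel)
  qed
  \<comment> \<open>Empty columns contribute the factor 1 and full columns the factor
    \<open>det M\<close>; both can be cancelled when \<open>M\<close> is invertible.\<close>
  have rel_J: "(\<Sum>C\<in>?S. lam C * (\<Prod>j\<in>J. det (submatrix M (column C j) (column D j)))) = 0"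
    if M: "M \<in> carrier_mat n n" and det: "det M \<noteq> 0" for M
  proof -
    let ?c = "\<Prod>j\<in>{..<n} - J. det (submatrix M (column D j) (column D j))"
    have "det (submatrix M (column D j) (column D j)) \<noteq> 0" if j: "j \<in> {..<n} - J" for j
    proof -
      consider "column D j = {}" | "column D j = {..<n}"
        using j by (auto simp: J_def)
      then show ?thesis
      proof cases
        case 1
        then have "submatrix M (column D j) (column D j) \<in> carrier_mat 0 0"
          using submatrix_carrier[OF M] by simp
        then show ?thesis
          by (simp add: det_dim_zero)
      next
        case 2
        then show ?thesis
          using det by (simp add: submatrix_full[OF M])
      qed
    qed
    then have "?c \<noteq> 0"
      by simp
    have "(\<Prod>j<n. det (submatrix M (column C j) (column D j))) =
        ?c * (\<Prod>j\<in>J. det (submatrix M (column C j) (column D j)))" if "C \<in> ?S" for C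
    proof -
      have "(\<Prod>j<n. det (submatrix M (column C j) (column D j))) =
          (\<Prod>j\<in>{..<n} - J. det (submatrix M (column C j) (column D j))) *
          (\<Prod>j\<in>J. det (submatrix M (column C j) (column D j)))"
        by (rule prod.subset_diff) (auto simp: J_def)
      then show ?thesis
        using trivial[OF that] by simp
    qed
    then have "?c * (\<Sum>C\<in>?S. lam C * (\<Prod>j\<in>J. det (submatrix M (column C j) (column D j)))) = 0"
      using rel_all[OF M] by (simp add: sum_distrib_left ac_simps)
    then show ?thesis
      using \<open>?c \<noteq> 0\<close> by simp
  qed
  have pairs: "column D i \<inter> column D j = {} \<or> column D i \<union> column D j = {..<n}"
    if "i \<in> J" "j \<in> J" "i \<noteq> j" for i j
  proof (rule ccontr)
    assume "\<not> ?thesis"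
    moreover have "column D i \<union> column D j \<subseteq> {..<n}"
      using column_subset[OF D] by blast
    ultimately obtain r s where rs: "(r, i) \<in> D" "(r, j) \<in> D" "s < n" "(s, i) \<notin> D" "(s, j) \<notin> D"
      by (auto simp: column_def)
    then have lt: "r < n" "i < n" "j < n"
      using D that by (auto simp: diagrams_def J_def)
    have "r \<noteq> s"
      using rs by blast
    have avoid1: "\<not> (i1 < i2 \<and> i2 < n \<and> j1 < j2 \<and> j2 < n \<and>
        (i1, j1) \<notin> D \<and> (i1, j2) \<notin> D \<and> (i2, j1) \<in> D \<and> (i2, j2) \<in> D)" for i1 i2 j1 j2
      using avoid(1) unfolding has_first_configuration_def by blast
    have avoid2: "\<not> (i1 < i2 \<and> i2 < n \<and> j1 < j2 \<and> j2 < n \<and>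
        (i1, j1) \<in> D \<and> (i1, j2) \<in> D \<and> (i2, j1) \<notin> D \<and> (i2, j2) \<notin> D)" for i1 i2 j1 j2
      using avoid(2) unfolding has_second_configuration_def by blast
    show False
      using avoid1[of s r i j] avoid1[of s r j i] avoid2[of r s i j] avoid2[of r s j i]
        \<comment> \<open>Whether \<open>s < r\<close> or \<open>r < s\<close> decides between the
          first and the second configuration; the columns are taken in increasing order.\<close>
        rs \<open>i \<noteq> j\<close> \<open>r \<noteq> s\<close> lt by (auto simp: nat_neq_iff)
  qed
  have finJ: "finite J"
    by (simp add: J_def)
  have F: "column C j \<subseteq> {..<n} \<and> card (column C j) = card (column D j)" if "C \<in> ?S" "j \<in> J" for C j
    using that same_column_sizesD column_subset by (auto simp: J_def)
  have "disjoint_family_on (column D) J \<or> disjoint_family_on (\<lambda>j. {..<n} - column D j) J"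
    by (rule disjoint_or_codisjoint) (use pairs column_subset[OF D] in \<open>auto simp: J_def\<close>)
  then show ?thesis
  proof
    assume "disjoint_family_on (column D) J"
    then show ?thesis
      by (rule disjoint_minors_independent[OF finite_same_column_sizes finJ _ column_subset[OF D] F inj rel_J C0])
  next
    assume codisjoint: "disjoint_family_on (\<lambda>j. {..<n} - column D j) J"
    \<comment> \<open>The predicate says that \<open>t\<close> is a valid Jacobi scalar for
      \<open>C\<close> and \<open>j\<close>, so that one scalar \<open>s C j\<close> can be chosen
      for all matrices simultaneously.\<close>
    define R where "R C j t \<longleftrightarrow> t \<noteq> 0 \<and> (\<forall>M N. M \<in> carrier_mat n n \<longrightarrow> N \<in> carrier_mat n n \<longrightarrow>
        M * N = 1\<^sub>m n \<longrightarrow> det (submatrix M (column C j) (column D j)) =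
        t * det M * det (submatrix N ({..<n} - column D j) ({..<n} - column C j)))"
      for C j and t :: complex
    define s where "s C j = (SOME t. R C j t)" for C j
    have R: "R C j (s C j)" if "C \<in> ?S" "j \<in> J" for C j
    proof -
      have "\<exists>t. R C j t"
        unfolding R_def by (rule jacobi_complementary_minor) (use F[OF that] column_subset[OF D] in auto)
      then show ?thesis
        unfolding s_def by (rule someI_ex)
    qed
    from R have s0: "\<And>C j. C \<in> ?S \<Longrightarrow> j \<in> J \<Longrightarrow> s C j \<noteq> 0" and
      s: "\<And>C j M N. C \<in> ?S \<Longrightarrow> j \<in> J \<Longrightarrow> M \<in> carrier_mat n n \<Longrightarrow> N \<in> carrier_mat n n \<Longrightarrow> M * N = 1\<^sub>m n \<Longrightarrow>
        det (submatrix M (column C j) (column D j)) =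
        s C j * det M * det (submatrix N ({..<n} - column D j) ({..<n} - column C j))"
      unfolding R_def by blast+
    have "lam C0 * (\<Prod>j\<in>J. s C0 j) = 0"
    proof (rule disjoint_minors_independent[where lam = "\<lambda>C. lam C * (\<Prod>j\<in>J. s C j)", OF _ finJ codisjoint])
      fix C j
      assume "C \<in> ?S" "j \<in> J"
      from F[OF this] column_subset[OF D, of j]
      show "{..<n} - column C j \<subseteq> {..<n} \<and> card ({..<n} - column C j) = card ({..<n} - column D j)"
        using finite_subset[of _ "{..<n}"] by (auto simp: card_Diff_subset)
    next
      fix C C'
      assume "C \<in> ?S" "C' \<in> ?S" and eq: "\<And>j. j \<in> J \<Longrightarrow> {..<n} - column C j = {..<n} - column C' j"
      then show "C = C'"
      proof (intro inj)
        fix j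
        assume "j \<in> J"
        then show "column C j = column C' j"
          using eq[of j] F[of C j] F[of C' j] \<open>C \<in> ?S\<close> \<open>C' \<in> ?S\<close> by blast
      qed
    next
      fix M :: "complex mat"
      assume M: "M \<in> carrier_mat n n" and det: "det M \<noteq> 0"
      \<comment> \<open>Jacobi's formula exchanges the roles of rows and columns. Applying it to the
        inverse \<open>M'\<close> of the transpose restores them.\<close>
      let ?N = "transpose_mat M"
      have N: "?N \<in> carrier_mat n n" "det ?N \<noteq> 0"
        using M det by (simp_all add: det_transpose)
      then obtain M' where M': "M' \<in> carrier_mat n n" "M' * ?N = 1\<^sub>m n"
        using det_non_zero_imp_unit[OF N] unfolding Units_def by (auto simp: ring_mat_simps)
      then have "det M' * det ?N = 1"
        using det_mult[OF M'(1) N(1)] by simp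
      then have det': "det M' \<noteq> 0"
        by auto
      have minor: "det (submatrix M' (column C j) (column D j)) =
          s C j * det M' * det (submatrix M ({..<n} - column C j) ({..<n} - column D j))"
        if "C \<in> ?S" "j \<in> J" for C j
      proof -
        let ?I = "{..<n} - column C j" and ?K = "{..<n} - column D j"
        have "card ?I = card ?K"
          using F[OF that] column_subset[OF D, of j] finite_subset[of _ "{..<n}"]
          by (auto simp: card_Diff_subset)
        then have "det (submatrix M ?I ?K) = det (transpose_mat (submatrix M ?I ?K))"
          by (subst det_transpose[of _ "card ?I"]) (simp_all add: submatrix_carrier[OF M])
        also have "transpose_mat (submatrix M ?I ?K) = submatrix ?N ?K ?I"
          using M by (auto simp: submatrix_carrier[OF M] submatrix_carrier[OF N(1)] pick_less intro!: eq_matI)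
        finally show ?thesis
          using s[OF that M'(1) N(1) M'(2)] by simp
      qed
      \<comment> \<open>Each \<open>j\<close> in \<open>J\<close> contributes one factor
        \<open>det M'\<close> and one scalar \<open>s C j\<close>.\<close>
      have "det M' ^ card J * (\<Sum>C\<in>?S. lam C * (\<Prod>j\<in>J. s C j) *
          (\<Prod>j\<in>J. det (submatrix M ({..<n} - column C j) ({..<n} - column D j)))) =
          (\<Sum>C\<in>?S. lam C * (\<Prod>j\<in>J. det (submatrix M' (column C j) (column D j))))"
        by (simp add: sum_distrib_left minor prod.distrib ac_simps)
      then show "(\<Sum>C\<in>?S. lam C * (\<Prod>j\<in>J. s C j) *
          (\<Prod>j\<in>J. det (submatrix M ({..<n} - column C j) ({..<n} - column D j)))) = 0"
        using rel_J[OF M'(1) det'] det' by simp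
    qed (use C0 finite_same_column_sizes in auto)
    then show ?thesis
      using s0[OF C0] finJ by simp
  qed
qed

section \<open>Attaining the bound as linear independence\<close>

text \<open>At \<open>x = 1\<close> the character is the dimension and the bound is the number of
  diagrams, so equality makes the generators distinct and independent. Conversely, an independent
  family is a basis of weight vectors. The right side concerns the indexed family, so it includes
  injectivity.\<close>

lemma schur_char_attains_bound_iff:
  assumes D: "D \<in> diagrams n"
  defines "S \<equiv> same_column_sizes n D"
  shows "(\<forall>x :: nat \<Rightarrow> complex. (\<forall>i<n. x i \<noteq> 0) \<longrightarrow>
            schur_char n D x = (\<Sum>C\<in>S. diagram_monomial n x C)) \<longleftrightarrow>
         (\<forall>lam. (\<Sum>C\<in>S. yscale (lam C) (weyl_generator n D C)) = 0 \<longrightarrow> (\<forall>C\<in>S. lam C = 0))"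
    (is "?char \<longleftrightarrow> ?indep")
proof
  let ?g = "weyl_generator n D"
  have fin: "finite S"
    unfolding S_def by (rule finite_same_column_sizes)
  {
    assume char: ?char
    obtain B where B: "B \<subseteq> ?g ` S" "ypoly.independent B" "?g ` S \<subseteq> ypoly.span B"
      using ypoly.maximal_independent_subset by blast
    then have "ypoly.span B = weyl_module n D"
      unfolding weyl_module_def S_def[symmetric] by (metis ypoly.span_eq ypoly.span_superset subset_trans)
    then have "schur_char n D (\<lambda>_. 1) = (\<Sum>b\<in>B. 1)"
      using B D by (intro schur_char_eq_basis_sum) (auto simp: S_def diagram_monomial_def)
    moreover have "schur_char n D (\<lambda>_. 1) = (\<Sum>C\<in>S. 1)"
      using char by (simp add: diagram_monomial_def)
    ultimately have "of_nat (card B) = (of_nat (card S) :: complex)"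
      by simp
    then have card: "card B = card S"
      using of_nat_eq_iff by blast
    \<comment> \<open>Equality of the outer terms forces equality throughout: the basis consists of
      all generators and no two diagrams share one.\<close>
    have "card B \<le> card (?g ` S)" "card (?g ` S) \<le> card S"
      using B(1) fin by (simp_all add: card_mono card_image_le)
    then have eq: "card (?g ` S) = card S" "B = ?g ` S"
      using card card_subset_eq[OF _ B(1)] fin by auto
    then have inj: "inj_on ?g S"
      using fin eq_card_imp_inj_on by blast
    show ?indep
    proof (intro allI impI ballI)
      fix lam C
      assume "(\<Sum>C\<in>S. yscale (lam C) (?g C)) = 0" and C: "C \<in> S"
      then have "(\<Sum>b\<in>B. yscale (lam (the_inv_into S ?g b)) b) = 0"
        unfolding eq(2) by (subst sum.reindex[OF inj]) (simp add: the_inv_into_f_f[OF inj])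
      from ypoly.independentD[OF B(2) _ order_refl this, of "?g C"] C
      show "lam C = 0"
        using fin by (simp add: eq(2) the_inv_into_f_f[OF inj])
    qed
  }
  {
    assume indep: ?indep
    have inj: "inj_on ?g S"
    proof (rule inj_onI, rule ccontr)
      fix C C'
      assume C: "C \<in> S" "C' \<in> S" "?g C = ?g C'" "C \<noteq> C'"
      \<comment> \<open>Two diagrams with the same generator would give a relation with coefficients
        1 and -1.\<close>
      let ?lam = "\<lambda>E. (if E = C then 1 else 0) - (if E = C' then 1 else 0)"
      have "(\<Sum>E\<in>S. yscale (?lam E) (?g E)) = 0"
        using C fin by (simp add: ypoly.scale_left_diff_distrib sum_subtractf if_distrib[of "\<lambda>c. yscale c _"]
          cong: if_cong)
      then show False
        using indep[rule_format, of ?lam C] C by simp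
    qed
    have "ypoly.independent (?g ` S)"
    proof (rule ypoly.independent_if_scalars_zero)
      fix u b
      assume "(\<Sum>x\<in>?g ` S. yscale (u x) x) = 0" "b \<in> ?g ` S"
      then show "u b = 0"
        using indep[rule_format, of "u \<circ> ?g"] by (auto simp: sum.reindex[OF inj])
    qed (use fin in simp)
    then have "schur_char n D x = (\<Sum>b\<in>?g ` S. diagram_monomial n x (the_inv_into S ?g b))"
      if "\<forall>i<n. x i \<noteq> 0" for x
      using that D
      by (intro schur_char_eq_basis_sum) (auto simp: weyl_module_def S_def[symmetric] the_inv_into_f_f[OF inj])
    then show ?char
      by (simp add: sum.reindex[OF inj] the_inv_into_f_f[OF inj])
  }
qed

section \<open>A relation between products of two minors\<close>

text \<open>The rows form a list rather than a set, so that they may be permuted or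
  repeated.\<close>

definition row_minor :: "(nat \<Rightarrow> nat \<Rightarrow> 'a :: comm_ring_1) \<Rightarrow> nat set \<Rightarrow> (nat \<Rightarrow> nat) \<Rightarrow> 'a" where
  "row_minor Y A r = det (mat (card A) (card A) (\<lambda>(i, j). Y (r i) (pick A j)))"

lemma row_minor_cong: "(\<And>i. i < card A \<Longrightarrow> r i = r' i) \<Longrightarrow> row_minor Y A r = row_minor Y A r'"
  unfolding row_minor_def by (intro arg_cong[of _ _ det] cong_mat) auto

lemma row_minor_permute:
  assumes p: "p permutes {0..<card A}" and r': "\<And>i. i < card A \<Longrightarrow> r' i = r (p i)"
  shows "row_minor Y A r' = signof p * row_minor Y A r"
proof -
  let ?N = "mat (card A) (card A) (\<lambda>(i, j). Y (r i) (pick A j))"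
  have "row_minor Y A r' = det (mat (card A) (card A) (\<lambda>(i, j). ?N $$ (p i, j)))"
    unfolding row_minor_def using r' permutes_in_image[OF p]
    by (intro arg_cong[of _ _ det] cong_mat) auto
  also have "\<dots> = signof p * det ?N"
    by (rule det_permute_rows) (use p in auto)
  finally show ?thesis
    by (simp add: row_minor_def)
qed

lemma row_minor_eq_0:
  assumes "\<not> inj_on r {..<card A}"
  shows "row_minor Y A r = 0"
proof -
  obtain i j where "i < card A" "j < card A" "i \<noteq> j" "r i = r j"
    using assms by (auto simp: inj_on_def)
  then show ?thesis
    unfolding row_minor_def by (intro det_identical_rows[of _ "card A" i j]) auto
qed

lemma row_minor_sort:
  assumes "inj_on r {..<card A}"
  obtains p where "row_minor Y A r = signof p * row_minor Y A (pick (r ` {..<card A}))"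
proof -
  let ?k = "card A" and ?R = "r ` {..<card A}"
  have card: "card ?R = ?k"
    using assms by (simp add: card_image)
  have pick: "bij_betw (pick ?R) {..<?k} ?R"
    using bij_betw_pick[of ?R] by (simp add: card)
  define p where "p = (\<lambda>i. if i < ?k then the_inv_into {..<?k} (pick ?R) (r i) else i)"
  have "bij_betw (the_inv_into {..<?k} (pick ?R) \<circ> r) {..<?k} {..<?k}"
    using assms bij_betw_the_inv_into[OF pick] by (intro bij_betw_trans[of r _ ?R]) (simp_all add: bij_betw_def)
  then have "bij_betw p {..<?k} {..<?k}"
    by (rule bij_betw_cong[THEN iffD1, rotated]) (simp add: p_def)
  then have "p permutes {0..<?k}"
    by (intro bij_imp_permutes) (auto simp: p_def lessThan_atLeast0)
  moreover have "r i = pick ?R (p i)" if "i < ?k" for i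
    using that f_the_inv_into_f_bij_betw[OF pick, of "r i"] by (simp add: p_def)
  ultimately show ?thesis
    using that row_minor_permute by blast
qed

lemma row_minor_leibniz:
  "row_minor Y A r = (\<Sum>p | p permutes {0..<card A}. signof p * (\<Prod>i<card A. Y (r i) (pick A (p i))))"
proof -
  have "(\<Prod>i = 0..<card A. mat (card A) (card A) (\<lambda>(i, j). Y (r i) (pick A j)) $$ (i, p i)) =
      (\<Prod>i<card A. Y (r i) (pick A (p i)))" if "p permutes {0..<card A}" for p
  proof (rule prod.cong)
    fix i
    assume "i \<in> {..<card A}"
    moreover from this have "p i < card A"
      using permutes_in_image[OF that, of i] by simp
    ultimately show "mat (card A) (card A) (\<lambda>(i, j). Y (r i) (pick A j)) $$ (i, p i) = Y (r i) (pick A (p i))"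
      by simp
  qed auto
  then show ?thesis
    by (simp add: row_minor_def det_def)
qed

text \<open>This is the Leibniz expansion of the determinant with entry \<open>Y l (f k)\<close> at
  \<open>(k, l)\<close>, which has two equal rows.\<close>

lemma alternating_monomial_sum_zero:
  fixes Y :: "nat \<Rightarrow> nat \<Rightarrow> 'a :: comm_ring_1"
  assumes "\<not> inj_on f {..<m}"
  shows "(\<Sum>p | p permutes {0..<m}. signof p * (\<Prod>k<m. Y (p k) (f k))) = 0"
proof -
  obtain k l where kl: "k < m" "l < m" "k \<noteq> l" "f k = f l"
    using assms by (auto simp: inj_on_def)
  let ?N = "mat m m (\<lambda>(k, l). Y l (f k))"
  have "(\<Prod>i = 0..<m. ?N $$ (i, p i)) = (\<Prod>k<m. Y (p k) (f k))" if "p permutes {0..<m}" for p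
  proof (rule prod.cong)
    fix i
    assume "i \<in> {..<m}"
    moreover from this have "p i < m"
      using permutes_in_image[OF that, of i] by simp
    ultimately show "?N $$ (i, p i) = Y (p i) (f i)"
      by simp
  qed auto
  then have "(\<Sum>p | p permutes {0..<m}. signof p * (\<Prod>k<m. Y (p k) (f k))) = det ?N"
    by (simp add: det_def)
  also have "\<dots> = 0"
    by (rule det_identical_rows[of _ m k l]) (use kl in auto)
  finally show ?thesis .
qed

text \<open>
  After expanding both minors, each term assigns to the \<open>m\<close> permuted rows columns in \<open>A \<union> B\<close>,
  so that two rows share a column.
\<close>

lemma row_minor_product_relation:
  fixes Y :: "nat \<Rightarrow> nat \<Rightarrow> 'a :: comm_ring_1"
  assumes "finite A" "finite B" "card (A \<union> B) < m" "d + card B = m" "d \<le> card A"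
  shows "(\<Sum>p | p permutes {0..<m}. signof p * (row_minor Y A p *
           row_minor Y B (\<lambda>i. if d + i < card A then d + i else p (d + i)))) = 0"
proof -
  define a where "a = card A"
  define b where "b = card B"
  have "a \<le> card (A \<union> B)"
    unfolding a_def using assms by (intro card_mono) auto
  then have am: "a \<le> m" and da: "d \<le> a" and db: "d + b = m"
    using assms by (simp_all add: a_def b_def)
  \<comment> \<open>The second minor occupies the positions \<open>d\<close> to
    \<open>m - 1\<close>; those below \<open>a\<close> keep their rows fixed, the others are
    permuted.\<close>
  let ?h = "\<lambda>p i. if d + i < a then d + i else p (d + i)"
  let ?S = "\<lambda>k. {p. p permutes {0..<k}}"
  let ?f = "\<lambda>s p. \<Prod>i<a. Y (p i) (pick A (s i))"
  let ?g = "\<lambda>t p. \<Prod>i<b. Y (?h p i) (pick B (t i))"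
  have inner: "(\<Sum>p\<in>?S m. signof p * (?f s p * ?g t p)) = 0"
    if st: "s permutes {0..<a}" "t permutes {0..<b}" for s t
  proof -
    \<comment> \<open>The column paired with the row \<open>p k\<close>: for \<open>k < a\<close>
      the factor comes from the first minor, otherwise from the second.\<close>
    define c where "c = (\<lambda>k. if k < a then pick A (s k) else pick B (t (k - d)))"
    have "c k \<in> A \<union> B" if "k < m" for k
    proof (cases "k < a")
      case True
      then have "s k < a"
        using permutes_in_image[OF st(1)] by simp
      then show ?thesis
        using True by (simp add: c_def a_def pick_in_set)
    next
      case False
      then have "t (k - d) < b"
        using permutes_in_image[OF st(2), of "k - d"] \<open>k < m\<close> da db by simp
      then show ?thesis
        using False by (simp add: c_def b_def pick_in_set)
    qed
    then have "c ` {..<m} \<subseteq> A \<union> B"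
      by auto
    then have "\<not> inj_on c {..<m}"
      using assms(1-3) card_inj_on_le[of c "{..<m}" "A \<union> B"] by auto
    note zero = alternating_monomial_sum_zero[OF this, of Y]
    let ?const = "\<Prod>i<a - d. Y (d + i) (pick B (t i))"
    have "?f s p * ?g t p = ?const * (\<Prod>k<m. Y (p k) (c k))" for p
    proof -
      have "?g t p = (\<Prod>i\<in>{0..<a - d}. Y (?h p i) (pick B (t i))) * (\<Prod>i\<in>{a - d..<b}. Y (?h p i) (pick B (t i)))"
        using da db am by (subst prod.atLeastLessThan_concat) (simp_all add: lessThan_atLeast0)
      also have "(\<Prod>i\<in>{0..<a - d}. Y (?h p i) (pick B (t i))) = ?const"
        by (rule prod.cong) auto
      also have "(\<Prod>i\<in>{a - d..<b}. Y (?h p i) (pick B (t i))) = (\<Prod>i\<in>{a - d..<b}. Y (p (i + d)) (c (i + d)))"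
        by (rule prod.cong) (auto simp: c_def add.commute)
      also have "\<dots> = (\<Prod>k\<in>{a..<m}. Y (p k) (c k))"
        using prod.shift_bounds_nat_ivl[of "\<lambda>k. Y (p k) (c k)" "a - d" d b] da db by (simp add: add.commute)
      finally have g: "?g t p = ?const * (\<Prod>k\<in>{a..<m}. Y (p k) (c k))" .
      have "?f s p = (\<Prod>k\<in>{0..<a}. Y (p k) (c k))"
        by (rule prod.cong) (auto simp: c_def)
      moreover have "(\<Prod>k<m. Y (p k) (c k)) = (\<Prod>k\<in>{0..<a}. Y (p k) (c k)) * (\<Prod>k\<in>{a..<m}. Y (p k) (c k))"
        using prod.atLeastLessThan_concat[of 0 a m "\<lambda>k. Y (p k) (c k)"] am by (simp add: lessThan_atLeast0)
      ultimately show ?thesis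
        using g by (simp only: ac_simps)
    qed
    then have "(\<Sum>p\<in>?S m. signof p * (?f s p * ?g t p)) =
        ?const * (\<Sum>p\<in>?S m. signof p * (\<Prod>k<m. Y (p k) (c k)))"
      by (simp add: sum_distrib_left ac_simps)
    then show ?thesis
      by (simp add: zero)
  qed
  have "(\<Sum>p\<in>?S m. signof p * (row_minor Y A p * row_minor Y B (?h p))) =
      (\<Sum>p\<in>?S m. \<Sum>s\<in>?S a. \<Sum>t\<in>?S b. signof s * signof t * (signof p * (?f s p * ?g t p)))"
    unfolding row_minor_leibniz a_def[symmetric] b_def[symmetric] sum_product unfolding sum_distrib_left
    by (intro sum.cong refl) (simp only: ac_simps)
  also have "\<dots> = (\<Sum>s\<in>?S a. \<Sum>t\<in>?S b. \<Sum>p\<in>?S m. signof s * signof t * (signof p * (?f s p * ?g t p)))"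
    by (subst sum.swap, rule sum.cong[OF refl], rule sum.swap)
  also have "\<dots> = 0"
    using inner by (simp flip: sum_distrib_left)
  finally show ?thesis
    by (simp add: a_def)
qed

text \<open>Such a \<open>p\<close> is a permutation of the first \<open>card A\<close> positions
  times one of the remaining positions. Each permutes the rows of one minor, and the resulting signs
  cancel \<open>signof p\<close>. Hence these terms of the alternating sum reinforce each
  other.\<close>

lemma row_minor_product_stabilizer:
  assumes p: "p permutes {0..<m}" and im: "p ` {..<card A} = {..<card A}"
    and "card A \<le> m" "d + card B = m" "d \<le> card A"
  shows "signof p * (row_minor Y A p *
           row_minor Y B (\<lambda>i. if d + i < card A then d + i else p (d + i))) =
         row_minor Y A id * row_minor Y B (\<lambda>i. d + i)"
proof -
  define a where "a = card A"
  define b where "b = card B"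
  have am: "a \<le> m" and da: "d \<le> a" and db: "d + b = m" and im: "p ` {..<a} = {..<a}"
    using assms by (simp_all add: a_def b_def)
  have inj: "inj p"
    using p by (rule permutes_inj)
  have im2: "p ` {a..<m} = {a..<m}"
  proof -
    have "{a..<m} = {0..<m} - {..<a}"
      using am by auto
    then show ?thesis
      using im permutes_image[OF p] by (simp add: image_set_diff[OF inj])
  qed
  define p1 where "p1 = (\<lambda>i. if i < a then p i else i)"
  define p2 where "p2 = (\<lambda>i. if a \<le> i then p i else i)"
  have p1: "p1 permutes {0..<a}"
    using im inj_on_subset[OF inj subset_UNIV]
    by (intro bij_imp_permutes) (auto simp: p1_def bij_betw_def inj_on_def inj_eq[OF inj] lessThan_atLeast0)
  have p2: "p2 permutes {a..<m}"
    using im2 permutes_not_in[OF p]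
    by (intro bij_imp_permutes) (auto simp: p2_def bij_betw_def inj_on_def inj_eq[OF inj])
  have "p = p1 \<circ> p2"
  proof
    fix i
    have "a \<le> p i" if "a \<le> i" "i < m"
      using im2 that by (metis atLeastLessThan_iff imageI)
    then show "p i = (p1 \<circ> p2) i"
      using permutes_not_in[OF p, of i] am by (cases "i < m") (auto simp: p1_def p2_def)
  qed
  then have sign_p: "sign p = sign p1 * sign p2"
    using p1 p2 permutes_imp_permutation by (auto intro: sign_compose)
  \<comment> \<open>The rotation \<open>q\<close> by \<open>d\<close> conjugates \<open>p2\<close> to a permutation of \<open>{0..<b}\<close> with the same sign.\<close>
  define q where "q = (\<lambda>i. if i < b then d + i else if i < m then i - b else i)"
  have "bij_betw q {0..<m} {0..<m}"
    by (rule bij_betw_byWitness[of _ "\<lambda>k. if k < d then k + b else k - d"]) (use db in \<open>auto simp: q_def\<close>)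
  then have q: "q permutes {0..<m}"
    by (rule bij_imp_permutes) (use db in \<open>auto simp: q_def\<close>)
  have perm: "permutation q" "permutation p2"
    using q p2 permutes_imp_permutation by blast+
  define t where "t = Hilbert_Choice.inv q \<circ> p2 \<circ> q"
  have sign_t: "sign t = sign p2"
    using perm by (simp add: t_def sign_compose sign_inverse permutation_compose permutation_inverse)
  have p2': "p2 permutes {0..<m}"
    using p2 by (rule permutes_subset) auto
  have q_t: "q (t i) = p2 (q i)" for i
    by (simp add: t_def permutes_inverses[OF q])
  have t: "t permutes {0..<b}"
  proof (rule permutes_superset)
    show "t permutes {0..<m}"
      unfolding t_def using q p2' by (intro permutes_compose permutes_inv)
    fix i
    \<comment> \<open>Here \<open>q i = i - b < d \<le> a\<close>, a position that \<open>p2\<close>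
      fixes.\<close>
    assume "i \<in> {0..<m} - {0..<b}"
    then have "p2 (q i) = q i"
      using da db by (auto simp: q_def p2_def)
    then show "t i = i"
      by (simp add: t_def permutes_inverses[OF q])
  qed
  have "row_minor Y A p = signof p1 * row_minor Y A id"
    using p1 by (intro row_minor_permute) (simp_all add: a_def p1_def)
  moreover have "row_minor Y B (\<lambda>i. if d + i < card A then d + i else p (d + i)) =
      signof t * row_minor Y B q"
    using t by (intro row_minor_permute) (auto simp: q_t b_def[symmetric] a_def[symmetric], auto simp: q_def p2_def)
  moreover have "row_minor Y B q = row_minor Y B (\<lambda>i. d + i)"
    by (rule row_minor_cong) (simp add: q_def b_def)
  moreover have "sign p * sign p1 * sign t = 1"
    by (simp add: sign_p sign_t mult.assoc mult.left_commute[of "sign p2"] sign_idempotent)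
  then have "signof p * signof p1 * signof t = (1 :: 'a)"
    by (metis of_int_1 of_int_mult)
  ultimately show ?thesis
    by (metis (no_types, lifting) mult.assoc mult.commute mult.left_commute mult_1)
qed

section \<open>Dependence of the generators\<close>

lemma det_Ymat_submatrix:
  assumes "P \<subseteq> {..<n}" "A \<subseteq> {..<n}" "card P = card A"
  shows "det (submatrix (Ymat n) P A) = row_minor (\<lambda>i j. yvar (i, j)) A (pick P)"
  using assms by (simp add: Ymat_def submatrix_mat row_minor_def)

lemma row_minor_yvar_sort:
  assumes "inj_on r {..<card A}" "r ` {..<card A} \<subseteq> {..<n}" "A \<subseteq> {..<n}"
  obtains c :: complex where "c \<noteq> 0"
    "row_minor (\<lambda>i j. yvar (i, j)) A r = yconst c * det (submatrix (Ymat n) (r ` {..<card A}) A)"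
proof -
  obtain p where "row_minor (\<lambda>i j. yvar (i, j)) A r =
      signof p * row_minor (\<lambda>i j. yvar (i, j)) A (pick (r ` {..<card A}))"
    using row_minor_sort[OF assms(1)] .
  also have "signof p = yconst (signof p)"
    by simp
  also have "row_minor (\<lambda>i j. yvar (i, j)) A (pick (r ` {..<card A})) =
      det (submatrix (Ymat n) (r ` {..<card A}) A)"
    using assms by (simp add: det_Ymat_submatrix card_image)
  finally show ?thesis
    by (intro that[of "signof p"]) (cases p rule: sign_cases, simp_all)
qed

definition replace_columns :: "(nat \<times> nat) set \<Rightarrow> nat \<Rightarrow> nat \<Rightarrow> nat set \<Rightarrow> nat set \<Rightarrow> (nat \<times> nat) set" where
  "replace_columns D j k P Q = {(i, l) \<in> D. l \<noteq> j \<and> l \<noteq> k} \<union> P \<times> {j} \<union> Q \<times> {k}"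

lemma column_replace_columns:
  assumes "j \<noteq> k"
  shows "column (replace_columns D j k P Q) l = (if l = j then P else if l = k then Q else column D l)"
  using assms by (auto simp: column_def replace_columns_def)

lemma replace_columns_same_sizes:
  assumes "D \<in> diagrams n" "j < n" "k < n" "j \<noteq> k" "P \<subseteq> {..<n}" "Q \<subseteq> {..<n}"
    "card P = card (column D j)" "card Q = card (column D k)"
  shows "replace_columns D j k P Q \<in> same_column_sizes n D"
proof -
  have "replace_columns D j k P Q \<in> diagrams n"
    using assms by (auto simp: diagrams_def replace_columns_def)
  then show ?thesis
    using assms by (simp add: same_column_sizes_def column_replace_columns)
qed

lemma weyl_generator_replace_columns:
  assumes "j < n" "k < n" "j \<noteq> k"
  shows "weyl_generator n D (replace_columns D j k P Q) =
    (\<Prod>l\<in>{..<n} - {j, k}. det (submatrix (Ymat n) (column D l) (column D l))) *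
    (det (submatrix (Ymat n) P (column D j)) * det (submatrix (Ymat n) Q (column D k)))"
proof -
  let ?f = "\<lambda>l. det (submatrix (Ymat n) (column (replace_columns D j k P Q) l) (column D l))"
  have "weyl_generator n D (replace_columns D j k P Q) = (\<Prod>l\<in>{..<n} - {j, k}. ?f l) * (\<Prod>l\<in>{j, k}. ?f l)"
    unfolding weyl_generator_def by (rule prod.subset_diff) (use assms in auto)
  also have "(\<Prod>l\<in>{..<n} - {j, k}. ?f l) =
      (\<Prod>l\<in>{..<n} - {j, k}. det (submatrix (Ymat n) (column D l) (column D l)))"
    by (rule prod.cong) (auto simp: column_replace_columns[OF assms(3)])
  finally show ?thesis
    using assms by (simp add: column_replace_columns)
qed

text \<open>Every term of the alternating sum is a multiple of a generator. The terms belonging to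
  the diagram of \<open>id\<close> are all equal, so under independence their sum could not vanish,
  although the relation says it does.\<close>

lemma weyl_generators_dependent:
  assumes D: "D \<in> diagrams n"
    and jk: "j < n" "k < n" "j \<noteq> k"
    and meet: "column D j \<inter> column D k \<noteq> {}"
    and cover: "column D j \<union> column D k \<noteq> {..<n}"
  shows "\<exists>lam. (\<Sum>C\<in>same_column_sizes n D. yscale (lam C) (weyl_generator n D C)) = 0 \<and>
    (\<exists>C\<in>same_column_sizes n D. lam C \<noteq> 0)"
proof (rule ccontr)
  let ?S = "same_column_sizes n D" and ?g = "weyl_generator n D"
  assume no_relation: "\<not> ?thesis"
  have indep: "lam C = 0" if "(\<Sum>C\<in>?S. yscale (lam C) (?g C)) = 0" "C \<in> ?S" for lam C
    using that no_relation by blast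
  define A where "A = column D j"
  define B where "B = column D k"
  \<comment> \<open>One row more than the available columns of \<open>Y\<close>;
    \<open>m \<le> n\<close> because \<open>A\<close> and \<open>B\<close> do not cover
    \<open>{..<n}\<close>. With \<open>d = m - card B\<close>, exactly
    \<open>card (A \<inter> B) - 1\<close> positions from \<open>d\<close> up to
    \<open>card A\<close> stay fixed, which makes sense because \<open>A\<close> and
    \<open>B\<close> meet.\<close>
  define m where "m = Suc (card (A \<union> B))"
  define d where "d = m - card B"
  have AB: "A \<subseteq> {..<n}" "B \<subseteq> {..<n}"
    using column_subset[OF D] by (simp_all add: A_def B_def)
  then have fin: "finite A" "finite B"
    using finite_subset by blast+
  have "A \<union> B \<subset> {..<n}"
    using AB cover unfolding A_def B_def by blast
  then have mn: "m \<le> n"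
    using psubset_card_mono[of "{..<n}" "A \<union> B"] by (simp add: m_def)
  have card: "card A \<le> card (A \<union> B)" "card B \<le> card (A \<union> B)"
    using fin by (simp_all add: card_mono)
  have "card (A \<inter> B) \<noteq> 0"
    using fin meet by (simp add: A_def B_def)
  then have dA: "d \<le> card A"
    using card_Un_Int[OF fin] by (simp add: d_def m_def)
  have am: "card A \<le> m" and db: "d + card B = m"
    using card by (simp_all add: d_def m_def)
  let ?Y = "\<lambda>i j. yvar (i, j)"
  let ?h = "\<lambda>p i. if d + i < card A then d + i else p (d + i)"
  define Pi where "Pi = {p :: nat \<Rightarrow> nat. p permutes {0..<m}}"
  define R where "R = (\<Prod>l\<in>{..<n} - {j, k}. det (submatrix (Ymat n) (column D l) (column D l)))"
  define F where "F p = R * (signof p * (row_minor ?Y A p * row_minor ?Y B (?h p)))" for p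
  define C where "C p = replace_columns D j k (p ` {..<card A}) (?h p ` {..<card B})" for p
  have finPi: "finite Pi"
    by (simp add: Pi_def finite_permutations)
  have sum_F: "sum F Pi = 0"
    using row_minor_product_relation[OF fin _ db dA, of ?Y]
    by (simp add: F_def Pi_def m_def flip: sum_distrib_left)
  \<comment> \<open>If the second row list has a repetition, \<open>C p\<close> may have a column of
    the wrong size, but then \<open>F p = 0\<close> and the coefficient 0 serves.\<close>
  define ok where "ok p c \<longleftrightarrow> F p = yscale c (?g (C p)) \<and> (C p \<in> ?S \<or> c = 0) \<and>
      (inj_on (?h p) {..<card B} \<longrightarrow> C p \<in> ?S \<and> c \<noteq> 0)" for p c
  have "\<exists>c. ok p c" if "p \<in> Pi" for p
  proof (cases "inj_on (?h p) {..<card B}")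
    case False
    then show ?thesis
      by (intro exI[of _ 0]) (simp add: ok_def F_def row_minor_eq_0)
  next
    case True
    have p: "p permutes {0..<m}"
      using that by (simp add: Pi_def)
    have lt: "p i < n" if "i < m" for i
      using permutes_in_image[OF p, of i] that mn by simp
    have sub: "p ` {..<card A} \<subseteq> {..<n}" "?h p ` {..<card B} \<subseteq> {..<n}"
      using lt am db mn by auto
    have inj: "inj_on p {..<card A}"
      using permutes_inj[OF p] inj_on_subset by blast
    obtain c1 where c1: "c1 \<noteq> 0"
      "row_minor ?Y A p = yconst c1 * det (submatrix (Ymat n) (p ` {..<card A}) A)"
      using row_minor_yvar_sort[OF inj sub(1) AB(1)] .
    obtain c2 where c2: "c2 \<noteq> 0"
      "row_minor ?Y B (?h p) = yconst c2 * det (submatrix (Ymat n) (?h p ` {..<card B}) B)"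
      using row_minor_yvar_sort[OF True sub(2) AB(2)] .
    have "C p \<in> ?S"
      unfolding C_def using card_image[OF inj] card_image[OF True]
      by (intro replace_columns_same_sizes D jk sub) (simp_all only: card_lessThan A_def B_def)
    moreover have "signof p * c1 * c2 \<noteq> 0"
      using c1(1) c2(1) by (cases p rule: sign_cases) simp_all
    moreover have "signof p = yconst (signof p)"
      by simp
    then have "F p = yscale (signof p * c1 * c2) (?g (C p))"
      unfolding F_def C_def weyl_generator_replace_columns[OF jk] c1(2) c2(2) R_def[symmetric]
        A_def[symmetric] B_def[symmetric] yscale_def yconst.hom_mult by (simp only: ac_simps)
    ultimately show ?thesis
      unfolding ok_def by blast
  qed
  then have "\<forall>p\<in>Pi. \<exists>c. ok p c"
    by blast
  then obtain c where "\<forall>p\<in>Pi. ok p (c p)"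
    by metis
  then have c: "\<And>p. p \<in> Pi \<Longrightarrow> F p = yscale (c p) (?g (C p))"
    "\<And>p. p \<in> Pi \<Longrightarrow> C p \<in> ?S \<or> c p = 0"
    "\<And>p. p \<in> Pi \<Longrightarrow> inj_on (?h p) {..<card B} \<Longrightarrow> C p \<in> ?S \<and> c p \<noteq> 0"
    unfolding ok_def by simp_all
  have id: "id \<in> Pi" "C id \<in> ?S" "c id \<noteq> 0"
    using c(3)[of id] by (simp_all add: Pi_def permutes_id inj_on_def)
  define H where "H = {p \<in> Pi. C p = C id}"
  have finH: "finite H" and idH: "id \<in> H"
    using finPi id by (simp_all add: H_def)
  \<comment> \<open>Collecting the terms by diagram turns \<open>sum_F\<close> into a relation
    between generators, whose coefficient at \<open>C id\<close> must vanish.\<close>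
  have "(\<Sum>E\<in>?S. yscale (\<Sum>p\<in>{p \<in> Pi. C p = E}. c p) (?g E)) =
      (\<Sum>E\<in>?S. \<Sum>p\<in>{p \<in> Pi. C p = E}. yscale (c p) (?g (C p)))"
    by (intro sum.cong refl) (simp add: ypoly.scale_sum_left)
  also have "\<dots> = (\<Sum>E\<in>?S. \<Sum>p\<in>{p \<in> {p \<in> Pi. C p \<in> ?S}. C p = E}. yscale (c p) (?g (C p)))"
    by (intro sum.cong refl) auto
  also have "\<dots> = (\<Sum>p\<in>{p \<in> Pi. C p \<in> ?S}. yscale (c p) (?g (C p)))"
    using finPi finite_same_column_sizes by (intro sum.group) auto
  also have "\<dots> = sum F Pi"
    using finPi c by (intro sum.mono_neutral_cong_left) auto
  finally have "(\<Sum>p\<in>H. c p) = 0"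
    using indep[of "\<lambda>E. \<Sum>p\<in>{p \<in> Pi. C p = E}. c p" "C id"] id by (simp add: sum_F H_def)
  then have "yscale (\<Sum>p\<in>H. c p) (?g (C id)) = 0"
    by simp
  then have "(\<Sum>p\<in>H. F p) = 0"
    by (simp add: ypoly.scale_sum_left c H_def)
  moreover have "F p = F id" if "p \<in> H" for p
  proof -
    have p: "p permutes {0..<m}"
      using that by (simp add: H_def Pi_def)
    \<comment> \<open>Column \<open>j\<close> records the rows of the first minor, so
      \<open>p\<close> stabilizes the first \<open>card A\<close> positions.\<close>
    have "column (C p) j = column (C id) j"
      using that by (simp add: H_def)
    then have "p ` {..<card A} = {..<card A}"
      by (simp add: C_def column_replace_columns[OF jk(3)])
    from row_minor_product_stabilizer[OF p this am db dA, of ?Y]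
      row_minor_product_stabilizer[OF permutes_id _ am db dA, of ?Y]
    show ?thesis
      by (simp add: F_def)
  qed
  ultimately have "of_nat (card H) * F id = 0"
    by simp
  then have "yscale (of_nat (card H) * c id) (?g (C id)) = 0"
    using c(1)[OF id(1)] by (simp add: yscale_def hom_distribs ac_simps)
  \<comment> \<open>Independence is used a second time, for the relation with the single term at
    \<open>C id\<close>; its coefficient is nonzero in characteristic 0.\<close>
  moreover have "(\<Sum>E\<in>?S. yscale (if E = C id then of_nat (card H) * c id else 0) (?g E)) =
      yscale (of_nat (card H) * c id) (?g (C id))"
    using id(2) finite_same_column_sizes by (simp add: if_distrib[of "\<lambda>c. yscale c _"] cong: if_cong)
  ultimately have "of_nat (card H) * c id = 0"
    using indep[of "\<lambda>E. if E = C id then of_nat (card H) * c id else 0" "C id"] id by simp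
  then show False
    using id(3) finH idH by auto
qed

section \<open>The criterion in terms of the two configurations\<close>

theorem theorem1p2:
  fixes n :: nat and D :: "(nat \<times> nat) set"
  assumes "n \<ge> 1"
    and "D \<in> diagrams n"
  shows "(\<forall>x :: nat \<Rightarrow> complex. (\<forall>i<n. x i \<noteq> 0) \<longrightarrow>
            schur_char n D x = (\<Sum>C\<in>same_column_sizes n D. diagram_monomial n x C))
         \<longleftrightarrow> \<not> has_first_configuration n D \<and> \<not> has_second_configuration n D"
proof -
  note D = assms(2)
  let ?indep = "\<forall>lam. (\<Sum>C\<in>same_column_sizes n D. yscale (lam C) (weyl_generator n D C)) = 0 \<longrightarrow>
    (\<forall>C\<in>same_column_sizes n D. lam C = 0)"
  \<comment> \<open>The order of \<open>r\<close> and \<open>s\<close> is left open, which covers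
    both configurations.\<close>
  have dependent: "\<not> ?indep"
    if "j1 < j2" "j2 < n" "(r, j1) \<in> D" "(r, j2) \<in> D" "s < n" "(s, j1) \<notin> D" "(s, j2) \<notin> D" for r s j1 j2
  proof -
    have "column D j1 \<inter> column D j2 \<noteq> {}" "column D j1 \<union> column D j2 \<noteq> {..<n}"
      using that by (auto simp: column_def)
    then show ?thesis
      using weyl_generators_dependent[OF D, of j1 j2] that by auto
  qed
  have "?indep \<longleftrightarrow> \<not> has_first_configuration n D \<and> \<not> has_second_configuration n D"
  proof
    assume indep: ?indep
    show "\<not> has_first_configuration n D \<and> \<not> has_second_configuration n D"
    proof (intro conjI notI)
      assume "has_first_configuration n D"
      then obtain i1 i2 j1 j2 where "i1 < i2" "i2 < n" "j1 < j2" "j2 < n"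
        "(i1, j1) \<notin> D" "(i1, j2) \<notin> D" "(i2, j1) \<in> D" "(i2, j2) \<in> D"
        unfolding has_first_configuration_def by blast
      then show False
        using dependent[of j1 j2 i2 i1] indep by simp
    next
      assume "has_second_configuration n D"
      then obtain i1 i2 j1 j2 where "i2 < n" "j1 < j2" "j2 < n"
        "(i1, j1) \<in> D" "(i1, j2) \<in> D" "(i2, j1) \<notin> D" "(i2, j2) \<notin> D"
        unfolding has_second_configuration_def by blast
      then show False
        using dependent[of j1 j2 i1 i2] indep by simp
    qed
  next
    assume "\<not> has_first_configuration n D \<and> \<not> has_second_configuration n D"
    then show ?indep
      using weyl_generators_independent[OF D] by blast
  qed
  then show ?thesis
    using schur_char_attains_bound_iff[OF D] by simp
qed

end
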